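(* Let $j:\mathbb{H}\to\mathbb{C}$ be Klein's $j$-function and let $$U=\left\{ z\in\mathbb{H} : |z|\ge 1,\ -\tfrac12<\operatorname{Re}(z)\le \tfrac12,\ \text{and if } \operatorname{Re}(z)<0 \text{ then } |z|>1\right\}$$ be its standard fundamental domain. Let $V\subset U$ be any nonempty open set. Then there is no $\mathbb{C}$-Pfaffian chain $(f_1,\ldots,f_l)$ on $V$ such that $j|_V$ is algebraic over the field $\mathbb{C}(z,f_1,\ldots,f_l)$ of functions on $V$.
   Context: $\mathbb{H}=\{z\in\mathbb{C}:\operatorname{Im} z>0\}$ is the upper half plane. Klein's $j$-function is the classical modular function, holomorphic on $\mathbb{H}$, invariant under $\mathrm{SL}_2(\mathbb{Z})$ acting by Möbius transformations, normalized so that $j(i)=1728$ and $j(e^{2\pi i/3})=0$. A $\mathbb{C}$-Pfaffian chain on a domain $V\subseteq\mathbb{C}^n$ is a tuple $(f_1,\ldots,f_l)$ of complex analytic functions on $V$ for which there exist polynomials $p_{ij}(u_1,\ldots,u_n,v_1,\ldots,v_i)$ with complex coefficients such that $\frac{\partial f_i}{\partial x_j}=p_{ij}(\bar x,f_1(\bar x),\ldots,f_i(\bar x))$ for all $1\le i\le l$, $1\le j\le n$. Here $n=1$ and the variable is $z$. *)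

theory Defs
  imports "HOL-Complex_Analysis.Complex_Analysis" "HOL-Library.Poly_Mapping"
begin

definition upper_half_plane :: "complex set" where
  "upper_half_plane = {z. Im z > 0}"

text \<open>
  The Eisenstein series is the sum over all nonzero points of the lattice
  $\mathbb{Z} + \mathbb{Z}\tau$; for $k \geq 3$ it converges absolutely on the upper half plane.
\<close>

definition eisenstein :: "nat \<Rightarrow> complex \<Rightarrow> complex" where
  "eisenstein k \<tau> =
     (\<Sum>\<^sub>\<infinity>(m, n) \<in> UNIV - {(0 :: int, 0 :: int)}. 1 / (of_int m + of_int n * \<tau>) ^ k)"

definition weierstrass_g2 :: "complex \<Rightarrow> complex" where
  "weierstrass_g2 \<tau> = 60 * eisenstein 4 \<tau>"

definition weierstrass_g3 :: "complex \<Rightarrow> complex" where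
  "weierstrass_g3 \<tau> = 140 * eisenstein 6 \<tau>"

text \<open>
  The factor 1728 gives the normalization $j(i) = 1728$, $j(e^{2\pi i/3}) = 0$. The denominator is
  the modular discriminant, which has no zero in the upper half plane; values of the function
  outside the upper half plane are meaningless.
\<close>

definition klein_j :: "complex \<Rightarrow> complex" where
  "klein_j \<tau> = 1728 * weierstrass_g2 \<tau> ^ 3 / (weierstrass_g2 \<tau> ^ 3 - 27 * weierstrass_g3 \<tau> ^ 2)"

definition fundamental_domain :: "complex set" where
  "fundamental_domain =
     {z \<in> upper_half_plane. norm z \<ge> 1 \<and> - 1 / 2 < Re z \<and> Re z \<le> 1 / 2 \<and> (Re z < 0 \<longrightarrow> norm z > 1)}"

text \<open>
  A polynomial in variables indexed by the natural numbers is a finitely supported map from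
  monomials to coefficients, a monomial being a finitely supported map from variables to
  exponents.
\<close>

type_synonym cpoly = "(nat \<Rightarrow>\<^sub>0 nat) \<Rightarrow>\<^sub>0 complex"

definition cpoly_vars :: "cpoly \<Rightarrow> nat set" where
  "cpoly_vars p = (\<Union>m \<in> Poly_Mapping.keys p. Poly_Mapping.keys m)"

definition cpoly_eval :: "cpoly \<Rightarrow> (nat \<Rightarrow> complex) \<Rightarrow> complex" where
  "cpoly_eval p x =
     (\<Sum>m \<in> Poly_Mapping.keys p.
        Poly_Mapping.lookup p m * (\<Prod>v \<in> Poly_Mapping.keys m. x v ^ Poly_Mapping.lookup m v))"

text \<open>
  A tuple $(f_1, \ldots, f_l)$ is encoded by a function \<open>f\<close> of the index, of which only the values
  at the indices $1, \ldots, l$ matter. Variable 0 of a polynomial stands for $z$ and variable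
  $i \geq 1$ stands for $f_i$.
\<close>

definition chain_point :: "(nat \<Rightarrow> complex \<Rightarrow> complex) \<Rightarrow> complex \<Rightarrow> nat \<Rightarrow> complex" where
  "chain_point f z i = (if i = 0 then z else f i z)"

definition pfaffian_chain :: "complex set \<Rightarrow> nat \<Rightarrow> (nat \<Rightarrow> complex \<Rightarrow> complex) \<Rightarrow> bool" where
  "pfaffian_chain V l f \<longleftrightarrow>
     (\<forall>i \<in> {1..l}. f i analytic_on V) \<and>
     (\<exists>p :: nat \<Rightarrow> cpoly. \<forall>i \<in> {1..l}. cpoly_vars (p i) \<subseteq> {0..i} \<and>
        (\<forall>z \<in> V. (f i has_field_derivative cpoly_eval (p i) (chain_point f z)) (at z)))"

text \<open>
  The meromorphic functions $P(z, f_1, \ldots, f_l) / Q(z, f_1, \ldots, f_l)$ on \<open>V\<close>. They are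
  to be identified when they agree outside a set without limit points in \<open>V\<close>, so that values at
  poles are immaterial. The denominator must not vanish identically near any point of \<open>V\<close>; when
  \<open>V\<close> is connected, this just says that it is not the zero function on \<open>V\<close>, and the quotients
  form the field $\mathbb{C}(z, f_1, \ldots, f_l)$. For disconnected \<open>V\<close> they still form a
  ring of meromorphic functions on \<open>V\<close> that contains $\mathbb{C}[z, f_1, \ldots, f_l]$.
\<close>

definition chain_field ::
    "complex set \<Rightarrow> nat \<Rightarrow> (nat \<Rightarrow> complex \<Rightarrow> complex) \<Rightarrow> (complex \<Rightarrow> complex) set" where
  "chain_field V l f =
     {(\<lambda>z. cpoly_eval P (chain_point f z) / cpoly_eval Q (chain_point f z)) | P Q.
        cpoly_vars P \<subseteq> {0..l} \<and> cpoly_vars Q \<subseteq> {0..l} \<and>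
        (\<forall>\<^sub>\<approx>z\<in>V. cpoly_eval Q (chain_point f z) \<noteq> 0)}"

text \<open>
  \<open>g\<close> is a root of a polynomial of degree at most \<open>d\<close> with coefficients in \<open>K\<close>, not all of them
  zero. All identities are between meromorphic functions on \<open>V\<close>, that is, they hold outside a set
  without limit points in \<open>V\<close>.
\<close>

definition algebraic_over_functions ::
    "complex set \<Rightarrow> (complex \<Rightarrow> complex) set \<Rightarrow> (complex \<Rightarrow> complex) \<Rightarrow> bool" where
  "algebraic_over_functions V K g \<longleftrightarrow>
     (\<exists>(d :: nat) (c :: nat \<Rightarrow> complex \<Rightarrow> complex).
        (\<forall>k \<le> d. c k \<in> K) \<and>
        (\<exists>k \<le> d. \<not> (\<forall>\<^sub>\<approx>z\<in>V. c k z = 0)) \<and>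
        (\<forall>\<^sub>\<approx>z\<in>V. (\<Sum>k\<le>d. c k z * g z ^ k) = 0))"

end

theory Submission
  imports Defs
begin

text \<open>
  Suppose that \<open>j\<close> is algebraic over a chain on \<open>V\<close>, and start from a small box in \<open>V\<close>. Every function
  of the chain extends holomorphically to a thinner box that crosses the real axis: along the
  chain, each function solves an equation \<open>y' = \<Sum>\<^sub>k A\<^sub>k(z) y\<^sup>k\<close> whose coefficients already extend, and
  the downward continuation of \<open>y\<close> on a vertical line can only be stopped at a point where \<open>y\<close> tends
  to infinity. There the equation for \<open>z\<close> as a function of \<open>1 / y\<close> is regular (wherever the leading
  coefficient is nonzero), so each stopping point is the value at 0 of an inverse branch of \<open>1 / y\<close>; there
  are only countably many of these, while there are uncountably many vertical lines. Clearing
  denominators, one obtains holomorphic functions \<open>W\<^sub>k\<close> on a box that meets the real line, not all zero,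
  with \<open>\<Sum>\<^sub>k W\<^sub>k j\<^sup>k = 0\<close> in the upper half of the box. For fixed \<open>\<tau>\<close> the orbit of \<open>\<tau>\<close> under the modular
  group accumulates at a rational point of the box, hence \<open>\<Sum>\<^sub>k W\<^sub>k(z) j(\<tau>)\<^sup>k = 0\<close> for all \<open>z\<close> and \<open>\<tau>\<close>, and
  every \<open>W\<^sub>k\<close> vanishes because \<open>j\<close> is not constant.
\<close>

section \<open>Local solutions of complex differential equations\<close>

text \<open>Moving z within its modular orbit changes the coefficients of the relation but not the
  value of j. The identity theorem can exploit this only if an orbit accumulates where the
  coefficients are holomorphic. Orbits are discrete in the upper half plane, so the coefficients
  must be carried past the real line, where j itself has no continuation. The obstacle is that a
  solution of a nonlinear equation may have poles and branch points that its coefficients do not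
  reveal, so no path is known in advance to be free of them. The freedom to choose among vertical
  lines makes up for this: one free line already gives a whole strip, since the set reached by
  continuation is open. Each function of the chain costs some width of the strip, and the chain is
  finite.\<close>

lemma has_field_derivative_bound_at_centre:
  fixes h :: "complex \<Rightarrow> complex"
  assumes h: "\<And>z. z \<in> ball a r \<Longrightarrow> (h has_field_derivative h' z) (at z)"
    and bd: "\<And>z. z \<in> ball a r \<Longrightarrow> norm (h' z) \<le> B"
    and z: "z \<in> ball a r"
  shows "norm (h z - h a) \<le> B * r"
proof -
  have r: "0 < r" using z by (auto simp: dist_norm intro: le_less_trans[OF norm_ge_zero])
  have "0 \<le> B" using bd[OF z] norm_ge_zero order_trans by blast
  have "norm (h z - h a) \<le> B * norm (z - a)"
    by (rule field_differentiable_bound[OF convex_ball, where f' = h'])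
       (use h bd z r in \<open>auto intro: has_field_derivative_at_within\<close>)
  also have "\<dots> \<le> B * r"
    using z \<open>0 \<le> B\<close> by (intro mult_left_mono) (auto simp: dist_norm norm_minus_commute)
  finally show ?thesis .
qed

text \<open>Picard iteration with holomorphic primitives in place of integrals:
  \<open>M * r \<le> R\<close> keeps the iterates in \<open>cball y0 R\<close>, and
  \<open>L * r \<le> 1/2\<close> makes the map a contraction. Holomorphy of \<open>F\<close> is
  asked only along holomorphic curves (\<open>hol\<close>), which each application can check by
  composition.\<close>

lemma complex_picard:
  fixes F :: "complex \<Rightarrow> complex \<Rightarrow> complex"
  assumes r: "0 < r" and R: "0 < R"
    and hol: "\<And>g. \<lbrakk>g holomorphic_on ball z0 r; g ` ball z0 r \<subseteq> cball y0 R\<rbrakk>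
                \<Longrightarrow> (\<lambda>z. F z (g z)) holomorphic_on ball z0 r"
    and bd: "\<And>z y. \<lbrakk>z \<in> ball z0 r; y \<in> cball y0 R\<rbrakk> \<Longrightarrow> norm (F z y) \<le> M"
    and lip: "\<And>z y y'. \<lbrakk>z \<in> ball z0 r; y \<in> cball y0 R; y' \<in> cball y0 R\<rbrakk>
                \<Longrightarrow> norm (F z y - F z y') \<le> L * norm (y - y')"
    and rM: "M * r \<le> R" and rL: "L * r \<le> 1/2"
  obtains g where "g ` ball z0 r \<subseteq> cball y0 R" "g z0 = y0"
    "\<And>z. z \<in> ball z0 r \<Longrightarrow> (g has_field_derivative F z (g z)) (at z)"
proof -
  define B where "B = ball z0 r"
  define K where "K = {g. g holomorphic_on B \<and> g ` B \<subseteq> cball y0 R}"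
  have L0: "0 \<le> L"
  proof -
    have "y0 + of_real R \<in> cball y0 R" using R by (auto simp: dist_norm)
    with lip[of z0 y0 "y0 + of_real R"] have "0 \<le> L * norm (y0 - (y0 + of_real R))"
      using r R by (meson centre_in_ball centre_in_cball less_imp_le norm_ge_zero order_trans)
    then show ?thesis using R by (simp add: zero_le_mult_iff)
  qed
  have step: "\<exists>h\<in>K. h z0 = y0 \<and> (\<forall>z\<in>B. (h has_field_derivative F z (g z)) (at z))"
    if "g \<in> K" for g
  proof -
    have "(\<lambda>z. F z (g z)) holomorphic_on B" using hol[of g] that by (auto simp: K_def B_def)
    then obtain h where h: "\<And>z. z \<in> B \<Longrightarrow> (h has_field_derivative F z (g z)) (at z)"
      using holomorphic_convex_primitive'[of B] by (auto simp: B_def at_within_open[OF _ open_ball])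
    define h1 where "h1 = (\<lambda>z. h z - h z0 + y0)"
    have d: "(h1 has_field_derivative F z (g z)) (at z)" if "z \<in> B" for z
      unfolding h1_def using h[OF that] by (auto intro!: derivative_eq_intros)
    have "h1 holomorphic_on B"
      by (rule holomorphic_onI) (use d in \<open>auto simp: field_differentiable_def intro: has_field_derivative_at_within\<close>)
    moreover have "h1 ` B \<subseteq> cball y0 R"
    proof (clarify)
      fix z assume z: "z \<in> B"
      have "norm (h1 z - h1 z0) \<le> M * r"
        by (rule has_field_derivative_bound_at_centre[where h = h1 and a = z0 and h' = "\<lambda>z. F z (g z)"])
           (use d bd that z in \<open>auto simp: B_def K_def image_subset_iff\<close>)
      also have "\<dots> \<le> R" by (rule rM)
      finally show "h1 z \<in> cball y0 R" by (simp add: h1_def dist_norm norm_minus_commute)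
    qed
    ultimately show ?thesis using d by (intro bexI[of _ h1]) (auto simp: K_def h1_def)
  qed
  then obtain T where T: "\<And>g. g \<in> K \<Longrightarrow> T g \<in> K" "\<And>g. g \<in> K \<Longrightarrow> T g z0 = y0"
      "\<And>g z. \<lbrakk>g \<in> K; z \<in> B\<rbrakk> \<Longrightarrow> (T g has_field_derivative F z (g z)) (at z)"
    by metis
  have contr: "norm (T g z - T h z) \<le> C / 2"
    if "g \<in> K" "h \<in> K" "\<And>z. z \<in> B \<Longrightarrow> norm (g z - h z) \<le> C" "z \<in> B" for g h C z
  proof -
    have "norm ((T g z - T h z) - (T g z0 - T h z0)) \<le> (L * C) * r"
    proof (rule has_field_derivative_bound_at_centre[where h = "\<lambda>z. T g z - T h z" and a = z0
          and h' = "\<lambda>w. F w (g w) - F w (h w)"])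
      fix w assume w: "w \<in> ball z0 r"
      show "((\<lambda>z. T g z - T h z) has_field_derivative (F w (g w) - F w (h w))) (at w)"
        using w by (intro DERIV_diff T(3) that) (auto simp: B_def)
      have "norm (F w (g w) - F w (h w)) \<le> L * norm (g w - h w)"
        using that(1,2) w by (intro lip) (auto simp: K_def B_def image_subset_iff)
      also have "\<dots> \<le> L * C" using L0 that(3) w by (intro mult_left_mono) (auto simp: B_def)
      finally show "norm (F w (g w) - F w (h w)) \<le> L * C" .
    qed (use that(4) in \<open>auto simp: B_def\<close>)
    also have "(L * C) * r = (L * r) * C" by simp
    also have "\<dots> \<le> 1/2 * C"
      using rL order_trans[OF norm_ge_zero that(3)[OF that(4)]] by (intro mult_right_mono)
    finally show ?thesis using T(2) that(1,2) by simp
  qed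
  define G where "G = (\<lambda>n. (T ^^ n) (\<lambda>_. y0))"
  have G_Suc: "G (Suc n) = T (G n)" for n by (simp add: G_def)
  have GK: "G n \<in> K" for n
  proof (induction n)
    case 0
    then show ?case using R by (auto simp: G_def K_def)
  qed (use T in \<open>simp add: G_Suc\<close>)
  have diff: "norm (G (Suc n) z - G n z) \<le> R * (1/2)^n" if "z \<in> B" for n z
    using that
  proof (induction n arbitrary: z)
    case 0
    have "G (Suc 0) z \<in> cball y0 R" using GK[of "Suc 0"] 0 by (auto simp: K_def)
    then show ?case by (simp add: G_def dist_norm norm_minus_commute)
  next
    case (Suc n)
    have "norm (G (Suc (Suc n)) z - G (Suc n) z) \<le> R * (1/2)^n / 2"
      unfolding G_Suc[of "Suc n"] G_Suc[of n]
      by (rule contr) (use GK Suc in \<open>auto simp: G_Suc[symmetric]\<close>)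
    then show ?case by simp
  qed
  have "uniform_limit B (\<lambda>n z. \<Sum>i<n. G (Suc i) z - G i z) (\<lambda>z. suminf (\<lambda>i. G (Suc i) z - G i z)) sequentially"
    by (rule Weierstrass_m_test[where M = "\<lambda>n. R * (1/2)^n"])
       (use diff in \<open>auto intro!: summable_mult summable_geometric\<close>)
  then obtain s where "uniform_limit B (\<lambda>n z. \<Sum>i<n. G (Suc i) z - G i z) s sequentially" by blast
  moreover have "(\<Sum>i<n. G (Suc i) z - G i z) = G n z - y0" for n z
    using sum_lessThan_telescope[of "\<lambda>i. G i z" n] by (simp add: G_def)
  ultimately have "uniform_limit B (\<lambda>n z. G n z - y0) s sequentially" by simp
  moreover have "uniform_limit B (\<lambda>_ _. y0) (\<lambda>_. y0) sequentially"
    by (rule uniform_limit_const)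
  ultimately have "uniform_limit B (\<lambda>n z. (G n z - y0) + y0) (\<lambda>z. s z + y0) sequentially"
    by (rule uniform_limit_add)
  then
  have lim: "uniform_limit B G g sequentially" if "g = (\<lambda>z. s z + y0)" for g
    using that by simp
  define g where "g = (\<lambda>z. s z + y0)"
  note lim = lim[OF g_def]
  have gh: "g holomorphic_on B"
  proof (rule holomorphic_uniform_sequence[where f = G])
    fix x assume "x \<in> B"
    then obtain e where "e > 0" "cball x e \<subseteq> B" using open_contains_cball[of B] unfolding B_def by (metis open_ball)
    then show "\<exists>d>0. cball x d \<subseteq> B \<and> uniform_limit (cball x d) G g sequentially"
      using lim uniform_limit_on_subset by blast
  qed (use GK in \<open>auto simp: B_def K_def\<close>)
  have ptl: "(\<lambda>n. G n z) \<longlonglongrightarrow> g z" if "z \<in> B" for z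
    using tendsto_uniform_limitI[OF lim that] .
  have gK: "g \<in> K"
  proof -
    have "g z \<in> cball y0 R" if "z \<in> B" for z
    proof (rule Lim_in_closed_set[OF _ _ _ ptl[OF that]])
      show "\<forall>\<^sub>F n in sequentially. G n z \<in> cball y0 R"
        using GK that by (intro always_eventually) (auto simp: K_def image_subset_iff)
    qed auto
    then show ?thesis using gh by (auto simp: K_def)
  qed
  have Tg: "T g z = g z" if z: "z \<in> B" for z
  proof -
    have "(\<lambda>n. G (Suc n) z) \<longlonglongrightarrow> T g z"
    proof (rule LIMSEQ_I)
      fix e :: real assume e: "e > 0"
      obtain N where N: "\<And>n z. \<lbrakk>n \<ge> N; z \<in> B\<rbrakk> \<Longrightarrow> dist (G n z) (g z) < e"
        using uniform_limitD[OF lim e] by (auto simp: eventually_sequentially)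
      have "norm (G (Suc n) z - T g z) < e" if n: "n \<ge> N" for n
      proof -
        have "norm (G (Suc n) z - T g z) \<le> e / 2"
          unfolding G_Suc
          by (rule contr[OF GK gK _ z]) (use N[OF n] in \<open>auto simp: dist_norm intro: less_imp_le\<close>)
        then show ?thesis using e by simp
      qed
      then show "\<exists>no. \<forall>n\<ge>no. norm (G (Suc n) z - T g z) < e" by blast
    qed
    moreover have "(\<lambda>n. G (Suc n) z) \<longlonglongrightarrow> g z" using ptl[OF z] by (rule LIMSEQ_Suc)
    ultimately show ?thesis by (rule LIMSEQ_unique)
  qed
  show thesis
  proof (rule that[of "T g"])
    show "T g ` ball z0 r \<subseteq> cball y0 R" using T(1)[OF gK] by (auto simp: K_def B_def)
    show "T g z0 = y0" using T(2)[OF gK] .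
    fix z assume "z \<in> ball z0 r"
    then show "(T g has_field_derivative F z (T g z)) (at z)" using T(3)[OF gK] Tg by (simp add: B_def)
  qed
qed

text \<open>A Gronwall-type uniqueness argument: once \<open>L' * s \<le> 1/2\<close>, the maximum
  of \<open>norm h\<close> on \<open>cball z0 s\<close> is at most half of itself. It is applied to
  the difference of two solutions and to \<open>Z (1 / Y z) - z\<close>.\<close>

lemma eventually_zero_if_deriv_bound:
  fixes h :: "complex \<Rightarrow> complex"
  assumes r: "0 < r" and h0: "h z0 = 0"
    and h: "\<And>z. z \<in> ball z0 r \<Longrightarrow> (h has_field_derivative h' z) (at z)"
    and bd: "\<And>z. z \<in> ball z0 r \<Longrightarrow> norm (h' z) \<le> L * norm (h z)"
  shows "\<forall>\<^sub>F z in nhds z0. h z = 0"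
proof -
  define L' where "L' = max L 1"
  define s where "s = min (r / 2) (1 / (2 * L'))"
  have L': "L' \<ge> 1" "L' \<ge> L" by (auto simp: L'_def)
  then have s: "0 < s" "s < r" using r by (auto simp: s_def)
  have Ls: "L' * s \<le> 1 / 2"
    using mult_left_mono[of s "1 / (2 * L')" L'] L' by (simp add: s_def)
  have sub: "cball z0 s \<subseteq> ball z0 r" using s by auto
  have "continuous_on (cball z0 s) (\<lambda>z. norm (h z))"
    using h sub by (intro continuous_intros continuous_at_imp_continuous_on) (meson DERIV_isCont subsetD)
  then obtain w where w: "w \<in> cball z0 s" "\<And>z. z \<in> cball z0 s \<Longrightarrow> norm (h z) \<le> norm (h w)"
    using continuous_attains_sup[of "cball z0 s" "\<lambda>z. norm (h z)"] s by auto
  have bound: "norm (h' z) \<le> L' * norm (h w)" if "z \<in> cball z0 s" for z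
  proof -
    have "norm (h' z) \<le> L * norm (h z)" using bd that sub by blast
    also have "\<dots> \<le> L' * norm (h z)" using L' by (intro mult_right_mono) auto
    also have "\<dots> \<le> L' * norm (h w)" using w(2)[OF that] L' by (intro mult_left_mono) auto
    finally show ?thesis .
  qed
  have "norm (h w - h z0) \<le> (L' * norm (h w)) * norm (w - z0)"
  proof (rule field_differentiable_bound[OF convex_cball[of z0 s], where f' = h'])
    show "(h has_field_derivative h' z) (at z within cball z0 s)" if "z \<in> cball z0 s" for z
      using h sub that by (meson has_field_derivative_at_within subsetD)
  qed (use bound w(1) s in auto)
  also have "\<dots> \<le> (L' * norm (h w)) * s"
    using w(1) L' by (intro mult_left_mono) (auto simp: dist_norm norm_minus_commute)
  also have "\<dots> = (L' * s) * norm (h w)" by simp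
  also have "\<dots> \<le> 1/2 * norm (h w)" using Ls by (intro mult_right_mono) auto
  finally have "norm (h w) \<le> 0" using h0 by simp
  then have "h z = 0" if "z \<in> ball z0 s" for z
    using w(2)[of z] that by (auto simp: less_imp_le)
  then show ?thesis
    using s(1) by (auto simp: eventually_nhds_metric dist_commute)
qed

section \<open>Downward continuation of solutions\<close>

definition rect :: "real \<Rightarrow> real \<Rightarrow> real \<Rightarrow> real \<Rightarrow> complex set" where
  "rect u v s t = box (Complex u s) (Complex v t)"

lemma mem_rect: "z \<in> rect u v s t \<longleftrightarrow> u < Re z \<and> Re z < v \<and> s < Im z \<and> Im z < t"
  by (auto simp: rect_def in_box_complex_iff)

lemma open_rect [simp, intro]: "open (rect u v s t)"
  and convex_rect [simp, intro]: "convex (rect u v s t)"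
  and connected_rect [simp, intro]: "connected (rect u v s t)"
  by (auto simp: rect_def open_box convex_box convex_connected)

lemma rect_eq_empty_iff: "rect u v s t = {} \<longleftrightarrow> v \<le> u \<or> t \<le> s"
proof -
  have "Complex ((u + v) / 2) ((s + t) / 2) \<in> rect u v s t" if "u < v" "s < t"
    using that by (auto simp: mem_rect)
  then show ?thesis by (fastforce simp: mem_rect not_less[symmetric])
qed

lemma holomorphic_zeros_sparse:
  assumes f: "f holomorphic_on S" and S: "open S" "connected S" and z: "z \<in> S" "f z \<noteq> 0"
  shows "{z \<in> S. f z = 0} sparse_in S"
  unfolding sparse_in_open[OF S(1)]
proof (intro ballI notI)
  fix w assume w: "w \<in> S" "w islimpt {z \<in> S. f z = 0}"
  have "f z = 0"
    by (rule analytic_continuation[OF f S _ w _ z(1)]) auto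
  then show False using z by simp
qed

lemma holomorphic_bound_lipschitz_cball:
  fixes f :: "complex \<Rightarrow> complex"
  assumes f: "f holomorphic_on S" and S: "open S" and sub: "cball a r \<subseteq> S"
  obtains C where "0 \<le> C" "\<And>z. z \<in> cball a r \<Longrightarrow> norm (f z) \<le> C"
    "\<And>z w. \<lbrakk>z \<in> cball a r; w \<in> cball a r\<rbrakk> \<Longrightarrow> norm (f z - f w) \<le> C * norm (z - w)"
proof -
  have "compact (f ` cball a r)" "compact (deriv f ` cball a r)"
    using f S sub holomorphic_deriv[OF f S]
    by (auto intro!: compact_continuous_image holomorphic_on_imp_continuous_on intro: holomorphic_on_subset)
  from this[THEN compact_imp_bounded]
  obtain C1 C2 where C: "\<And>z. z \<in> cball a r \<Longrightarrow> norm (f z) \<le> C1"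
      "\<And>z. z \<in> cball a r \<Longrightarrow> norm (deriv f z) \<le> C2"
    unfolding bounded_iff by (metis imageI)
  define C where "C = max 0 (max C1 C2)"
  show thesis
  proof (rule that[of C])
    fix z w assume zw: "z \<in> cball a r" "w \<in> cball a r"
    show "norm (f z - f w) \<le> C * norm (z - w)"
    proof (rule field_differentiable_bound[OF convex_cball])
      fix x assume "x \<in> cball a r"
      then show "(f has_field_derivative deriv f x) (at x within cball a r)"
        using f S sub by (meson has_field_derivative_at_within holomorphic_derivI subsetD)
      show "norm (deriv f x) \<le> C" using C(2)[OF \<open>x \<in> cball a r\<close>] by (simp add: C_def)
    qed (use zw in auto)
  qed (use C in \<open>simp_all add: C_def le_max_iff_disj\<close>)
qed

lemma holomorphic_family_bound_lipschitz_cball: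
  fixes f :: "nat \<Rightarrow> complex \<Rightarrow> complex"
  assumes f: "\<And>k. k \<le> N \<Longrightarrow> f k holomorphic_on S" and S: "open S" and sub: "cball a r \<subseteq> S"
  shows "\<exists>C\<ge>0. \<forall>k\<le>N. \<forall>z\<in>cball a r. norm (f k z) \<le> C \<and>
           (\<forall>w\<in>cball a r. norm (f k z - f k w) \<le> C * norm (z - w))"
proof -
  have "\<forall>k. \<exists>C. k \<le> N \<longrightarrow> 0 \<le> C \<and> (\<forall>z\<in>cball a r. norm (f k z) \<le> C) \<and>
      (\<forall>z\<in>cball a r. \<forall>w\<in>cball a r. norm (f k z - f k w) \<le> C * norm (z - w))"
    using holomorphic_bound_lipschitz_cball[OF f S sub] by metis
  then obtain C where C: "\<And>k. k \<le> N \<Longrightarrow> 0 \<le> C k" "\<And>k z. \<lbrakk>k \<le> N; z \<in> cball a r\<rbrakk> \<Longrightarrow> norm (f k z) \<le> C k"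
      "\<And>k z w. \<lbrakk>k \<le> N; z \<in> cball a r; w \<in> cball a r\<rbrakk> \<Longrightarrow> norm (f k z - f k w) \<le> C k * norm (z - w)"
    by metis
  have le: "C k \<le> (\<Sum>k\<le>N. C k)" if "k \<le> N" for k
    using that C(1) by (intro member_le_sum) auto
  have "0 \<le> (\<Sum>k\<le>N. C k)" using C(1) by (intro sum_nonneg) auto
  moreover have "norm (f k z) \<le> (\<Sum>k\<le>N. C k)" if "k \<le> N" "z \<in> cball a r" for k z
    using C(2)[OF that] le[OF that(1)] by linarith
  moreover have "norm (f k z - f k w) \<le> (\<Sum>k\<le>N. C k) * norm (z - w)"
    if "k \<le> N" "z \<in> cball a r" "w \<in> cball a r" for k z w
    using C(3)[OF that] mult_right_mono[OF le[OF that(1)], of "norm (z - w)"] by simp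
  ultimately show ?thesis by blast
qed

section \<open>Gluing the extensions of one solution along vertical lines\<close>

locale vertical_continuation =
  fixes a b c d e :: real and N :: nat and A :: "nat \<Rightarrow> complex \<Rightarrow> complex" and y :: "complex \<Rightarrow> complex"
  assumes ab: "a < b" and ce: "c < e" and ed: "e < d"
    and A: "\<And>k. k \<le> N \<Longrightarrow> A k holomorphic_on rect a b c d"
    and y: "\<And>z. z \<in> rect a b e d \<Longrightarrow> (y has_field_derivative (\<Sum>k\<le>N. A k z * y z ^ k)) (at z)"
begin

definition F :: "complex \<Rightarrow> complex \<Rightarrow> complex" where
  "F z w = (\<Sum>k\<le>N. A k z * w ^ k)"

text \<open>Every rectangle reaches up to height \<open>d\<close>. Two of them that share a point
  therefore also share points above \<open>e\<close>, where both extensions equal \<open>y\<close>;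
  this rules out monodromy.\<close>

definition ext :: "(complex \<Rightarrow> complex) \<Rightarrow> real \<Rightarrow> real \<Rightarrow> real \<Rightarrow> bool" where
  "ext g u v s \<longleftrightarrow> a \<le> u \<and> u < v \<and> v \<le> b \<and> c \<le> s \<and> s \<le> e \<and>
     (\<forall>z\<in>rect u v s d. (g has_field_derivative F z (g z)) (at z)) \<and> (\<forall>z\<in>rect u v e d. g z = y z)"

definition Om :: "complex set" where
  "Om = {z. \<exists>g u v s. ext g u v s \<and> z \<in> rect u v s d}"

definition Y :: "complex \<Rightarrow> complex" where
  "Y z = (SOME w. \<exists>g u v s. ext g u v s \<and> z \<in> rect u v s d \<and> w = g z)"

lemma ext_holomorphic: "ext g u v s \<Longrightarrow> g holomorphic_on rect u v s d"
  unfolding ext_def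
  by (meson field_differentiable_at_within field_differentiable_def holomorphic_onI)

lemma ext_y: "ext y a b e"
  using ab ce y by (auto simp: ext_def F_def)

lemma ext_agree:
  assumes g: "ext g u v s" and h: "ext h u' v' s'" and z: "z \<in> rect u v s d" "z \<in> rect u' v' s' d"
  shows "g z = h z"
proof -
  define U where "U = rect (max u u') (min v v') (max s s') d"
  define U1 where "U1 = rect (max u u') (min v v') e d"
  have le: "s \<le> e" "s' \<le> e" using g h by (auto simp: ext_def)
  show ?thesis
  proof (rule analytic_continuation_open[of U1 U g h])
    have "Complex (Re z) ((e + d) / 2) \<in> U1" using z ed by (auto simp: U1_def mem_rect)
    then show "U1 \<noteq> {}" by blast
    show "g holomorphic_on U" "h holomorphic_on U"
      using ext_holomorphic[OF g] ext_holomorphic[OF h]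
      by (auto simp: U_def mem_rect elim!: holomorphic_on_subset)
    show "g z = h z" if "z \<in> U1" for z
    proof -
      have "g z = y z" "h z = y z" using g h that by (auto simp: ext_def U1_def mem_rect)
      then show ?thesis by simp
    qed
  qed (use z le in \<open>auto simp: U_def U1_def mem_rect\<close>)
qed

lemma Y_eq:
  assumes "ext g u v s" "z \<in> rect u v s d"
  shows "Y z = g z"
proof -
  have "\<exists>w. \<exists>g u v s. ext g u v s \<and> z \<in> rect u v s d \<and> w = g z" using assms by blast
  from someI_ex[OF this] obtain g' u' v' s' where "ext g' u' v' s'" "z \<in> rect u' v' s' d" "Y z = g' z"
    unfolding Y_def by blast
  with ext_agree assms show ?thesis by metis
qed

lemma open_Om: "open Om"
proof -
  have "Om = (\<Union>{rect u v s d | u v s. \<exists>g. ext g u v s})" by (auto simp: Om_def) blast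
  then show ?thesis by auto
qed

lemma Y_deriv:
  assumes "z \<in> Om"
  shows "(Y has_field_derivative F z (Y z)) (at z)"
proof -
  obtain g u v s where g: "ext g u v s" "z \<in> rect u v s d" using assms by (auto simp: Om_def)
  have "(g has_field_derivative F z (g z)) (at z)" using g by (auto simp: ext_def)
  then show ?thesis
    unfolding Y_eq[OF g]
    by (rule has_field_derivative_transform_within_open[OF _ open_rect g(2)]) (simp add: Y_eq[OF g(1)])
qed

lemma Y_holomorphic: "Y holomorphic_on Om"
  by (rule holomorphic_onI) (meson Y_deriv field_differentiable_at_within field_differentiable_def)

lemma top_subset_Om: "rect a b e d \<subseteq> Om"
  using ext_y by (auto simp: Om_def)

text \<open>The radius of Picard's ball depends only on \<open>M\<close> and on the coefficients
  near the limit point, so a solution started close enough above \<open>s\<close> with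
  \<open>norm Y \<le> M\<close> survives below \<open>s\<close>. The bound is asked only at heights
  arbitrarily close to \<open>s\<close>, so that failure of the conclusion makes \<open>Y\<close>
  tend to infinity and not merely be unbounded.\<close>

lemma Om_extend:
  assumes x: "a < x" "x < b" and s: "c < s" "s < d"
    and above: "\<And>t. \<lbrakk>s < t; t < d\<rbrakk> \<Longrightarrow> Complex x t \<in> Om"
    and freq: "\<And>\<delta>. 0 < \<delta> \<Longrightarrow> \<exists>t. s < t \<and> t < s + \<delta> \<and> t < d \<and> norm (Y (Complex x t)) \<le> M"
  shows "Complex x s \<in> Om"
proof (cases "e < s")
  case True
  then show ?thesis using x s top_subset_Om by (auto simp: mem_rect subset_iff)
next
  case False
  then have se: "s \<le> e" by simp
  define zs where "zs = Complex x s"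
  have M0: "0 \<le> M" using freq[of 1] by (meson norm_ge_zero order_trans zero_less_one)
  have "zs \<in> rect a b c d" using x s by (simp add: zs_def mem_rect)
  then obtain \<eta> where \<eta>: "\<eta> > 0" "cball zs \<eta> \<subseteq> rect a b c d"
    using open_contains_cball open_rect by metis
  obtain C where C: "0 \<le> C" "\<And>k z. \<lbrakk>k \<le> N; z \<in> cball zs \<eta>\<rbrakk> \<Longrightarrow> norm (A k z) \<le> C"
    using holomorphic_family_bound_lipschitz_cball[of N A, OF A open_rect \<eta>(2)] by blast
  have "\<exists>P\<ge>0. \<forall>k\<le>N. \<forall>w\<in>cball (0 :: complex) (M + 1). norm (w ^ k) \<le> P \<and>
          (\<forall>w'\<in>cball 0 (M + 1). norm (w ^ k - w' ^ k) \<le> P * norm (w - w'))"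
    by (rule holomorphic_family_bound_lipschitz_cball[where S = UNIV]) (auto intro!: holomorphic_intros)
  then obtain P where P: "0 \<le> P" "\<And>k w. \<lbrakk>k \<le> N; w \<in> cball 0 (M + 1)\<rbrakk> \<Longrightarrow> norm (w ^ k :: complex) \<le> P"
      "\<And>k (w :: complex) w'. \<lbrakk>k \<le> N; w \<in> cball 0 (M + 1); w' \<in> cball 0 (M + 1)\<rbrakk> \<Longrightarrow> norm (w ^ k - w' ^ k) \<le> P * norm (w - w')"
    by blast
  define L where "L = of_nat (Suc N) * (C * P) + 1"
  have L: "L \<ge> 1" using C P by (simp add: L_def)
  have Fbd: "norm (F z w) \<le> L" if "z \<in> cball zs \<eta>" "w \<in> cball 0 (M + 1)" for z w
  proof -
    have "norm (F z w) \<le> of_nat (card {..N}) * (C * P)"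
      unfolding F_def
      by (rule sum_norm_bound) (use that C P in \<open>auto simp: norm_mult simp del: mem_cball intro!: mult_mono\<close>)
    then show ?thesis by (simp add: L_def)
  qed
  have Flip: "norm (F z w - F z w') \<le> L * norm (w - w')"
    if "z \<in> cball zs \<eta>" "w \<in> cball 0 (M + 1)" "w' \<in> cball 0 (M + 1)" for z w w'
  proof -
    have "F z w - F z w' = (\<Sum>k\<le>N. A k z * (w ^ k - w' ^ k))"
      by (simp add: F_def sum_subtractf algebra_simps)
    also have "norm \<dots> \<le> of_nat (card {..N}) * (C * (P * norm (w - w')))"
      by (rule sum_norm_bound)
         (use that C P in \<open>auto simp: norm_mult simp del: mem_cball intro!: mult_mono\<close>)
    also have "\<dots> \<le> L * norm (w - w')"
      by (simp add: L_def algebra_simps)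
    finally show ?thesis .
  qed
  \<comment> \<open>The first bound keeps the ball about any point within \<open>r / 2\<close> of
    \<open>zs\<close> inside \<open>cball zs \<eta>\<close>; the second makes Picard's map contract,
    with 1 as the radius in the target.\<close>
  define r where "r = min (\<eta> / 2) (1 / (2 * L))"
  have r: "r > 0" "r \<le> \<eta> / 2" using \<eta> L by (auto simp: r_def)
  have Lr: "L * r \<le> 1 / 2" using mult_left_mono[of r "1 / (2 * L)" L] L by (simp add: r_def)
  obtain t where t: "s < t" "t < s + r / 2" "t < d" "norm (Y (Complex x t)) \<le> M"
    using freq[of "r / 2"] r by auto
  define z1 where "z1 = Complex x t"
  have dz1: "dist zs z1 = t - s" using t by (simp add: zs_def z1_def dist_norm cmod_def)
  have b1: "ball z1 r \<subseteq> cball zs \<eta>"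
  proof
    fix z assume "z \<in> ball z1 r"
    then have "dist zs z \<le> (t - s) + r" using dist_triangle[of zs z z1] dz1 by (simp add: less_imp_le)
    also have "\<dots> \<le> \<eta>" using t r by linarith
    finally show "z \<in> cball zs \<eta>" by simp
  qed
  have b2: "cball (Y z1) 1 \<subseteq> cball 0 (M + 1)"
  proof
    fix w assume "w \<in> cball (Y z1) 1"
    then have "norm (w - Y z1) \<le> 1" by (simp add: dist_norm norm_minus_commute)
    moreover have "norm w \<le> norm (w - Y z1) + norm (Y z1)" by (metis norm_triangle_sub add.commute)
    ultimately show "w \<in> cball 0 (M + 1)" using t(4) by (simp add: z1_def)
  qed
  obtain g where g: "g ` ball z1 r \<subseteq> cball (Y z1) 1" "g z1 = Y z1"
      "\<And>z. z \<in> ball z1 r \<Longrightarrow> (g has_field_derivative F z (g z)) (at z)"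
  proof (rule complex_picard[of r 1 z1 "Y z1" F L L])
    fix g assume g: "g holomorphic_on ball z1 r"
    have "A k holomorphic_on ball z1 r" if "k \<le> N" for k
      using A[OF that] b1 \<eta> by (meson holomorphic_on_subset order_trans)
    then show "(\<lambda>z. F z (g z)) holomorphic_on ball z1 r"
      unfolding F_def using g by (intro holomorphic_intros) auto
  next
    show "norm (F z w) \<le> L" if "z \<in> ball z1 r" "w \<in> cball (Y z1) 1" for z w
      using that b1 b2 by (intro Fbd) blast+
    show "norm (F z w - F z w') \<le> L * norm (w - w')"
      if "z \<in> ball z1 r" "w \<in> cball (Y z1) 1" "w' \<in> cball (Y z1) 1" for z w w'
      using that b1 b2 by (intro Flip) blast+
  qed (use r Lr that in auto)
  have "z1 \<in> Om" using above t by (simp add: z1_def)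
  then obtain h u v p where h: "ext h u v p" "z1 \<in> rect u v p d" by (auto simp: Om_def)
  have hd: "(h has_field_derivative F z (h z)) (at z)" if "z \<in> rect u v p d" for z
    using h that by (auto simp: ext_def)
  have pe: "p \<le> e" "c \<le> p" "a \<le> u" "v \<le> b" using h by (auto simp: ext_def)
  have hz1: "h z1 = Y z1" using Y_eq[OF h] by simp
  have ev: "\<forall>\<^sub>F z in nhds z1. g z - h z = 0"
  proof -
    have "isCont h z1" using hd[OF h(2)] DERIV_isCont by blast
    then obtain \<rho>1 where \<rho>1: "\<rho>1 > 0" "\<And>z. dist z z1 < \<rho>1 \<Longrightarrow> dist (h z) (h z1) < 1"
      unfolding continuous_at_eps_delta using zero_less_one by blast
    obtain \<rho>2 where \<rho>2: "\<rho>2 > 0" "ball z1 \<rho>2 \<subseteq> rect u v p d"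
      using openE[OF open_rect h(2)] by blast
    define \<rho> where "\<rho> = min r (min \<rho>1 \<rho>2)"
    show ?thesis
    proof (rule eventually_zero_if_deriv_bound[where r = \<rho> and L = L])
      fix z assume z: "z \<in> ball z1 \<rho>"
      then have z': "z \<in> ball z1 r" "z \<in> rect u v p d" "h z \<in> cball (Y z1) 1"
        using \<rho>1(2)[of z] \<rho>2(2) hz1 by (auto simp: \<rho>_def dist_commute)
      show "((\<lambda>z. g z - h z) has_field_derivative (F z (g z) - F z (h z))) (at z)"
        using z' by (intro DERIV_diff g hd)
      show "norm (F z (g z) - F z (h z)) \<le> L * norm (g z - h z)"
        using z' g(1) b1 b2 by (intro Flip) blast+
    qed (use r \<rho>1 \<rho>2 g hz1 in \<open>auto simp: \<rho>_def\<close>)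
  qed
  \<comment> \<open>The rectangle around \<open>z1\<close> of half width \<open>\<epsilon>\<close>
    and half height \<open>r / 2\<close> must fit into \<open>ball z1 r\<close> and between the
    sides of the old extension.\<close>
  define \<epsilon> where "\<epsilon> = min (r / 2) (min (x - u) (v - x))"
  have \<epsilon>: "\<epsilon> > 0" "\<epsilon> \<le> r / 2" "u \<le> x - \<epsilon>" "x + \<epsilon> \<le> v"
  proof -
    have "u < x" "x < v" using h(2) by (auto simp: z1_def mem_rect)
    then show "\<epsilon> > 0" "\<epsilon> \<le> r / 2" "u \<le> x - \<epsilon>" "x + \<epsilon> \<le> v"
      using r unfolding \<epsilon>_def by linarith+
  qed
  \<comment> \<open>Since \<open>t < s + r / 2\<close> and \<open>c < s\<close>, this new bottom
    lies strictly below \<open>s\<close>.\<close>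
  define s' where "s' = max c (t - r / 2)"
  have s': "s' < s" "c \<le> s'" "t - r / 2 \<le> s'" using s t by (auto simp: s'_def)
  have near: "z \<in> ball z1 r" if "x - \<epsilon> < Re z" "Re z < x + \<epsilon>" "t - r / 2 < Im z" "Im z < t + r / 2" for z
  proof -
    have "norm (z - z1) \<le> \<bar>Re (z - z1)\<bar> + \<bar>Im (z - z1)\<bar>" by (rule cmod_le)
    also have "\<bar>Re (z - z1)\<bar> < \<epsilon>" using that by (simp add: z1_def abs_less_iff)
    also have "\<bar>Im (z - z1)\<bar> < r / 2" 
      using that unfolding z1_def minus_complex.sel complex.sel by linarith
    also have "\<epsilon> + r / 2 \<le> r" using \<epsilon> by simp
    finally show ?thesis by (simp add: dist_norm norm_minus_commute)
  qed
  define U where "U = rect (x - \<epsilon>) (x + \<epsilon>) (max p s') (min d (t + r / 2))"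
  have gh: "g z = h z" if "z \<in> U" for z
  proof -
    obtain \<rho> where \<rho>: "\<rho> > 0" "\<And>z. dist z z1 < \<rho> \<Longrightarrow> g z = h z"
      using ev by (auto simp: eventually_nhds_metric)
    have z1U: "z1 \<in> U" using h(2) \<epsilon> r t s' by (auto simp: U_def z1_def mem_rect)
    show ?thesis
    proof (rule analytic_continuation_open[of "U \<inter> ball z1 \<rho>" U g h])
      show "g holomorphic_on U"
      proof (rule holomorphic_onI)
        fix w assume "w \<in> U"
        then have "w \<in> ball z1 r" using s' by (intro near) (auto simp: U_def mem_rect)
        then show "g field_differentiable at w within U"
          using g(3) field_differentiable_at_within field_differentiable_def by blast
      qed
      show "h holomorphic_on U"
        using ext_holomorphic[OF h(1)] \<epsilon> by (auto simp: U_def mem_rect elim!: holomorphic_on_subset)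
      show "U \<inter> ball z1 \<rho> \<noteq> {}" using z1U \<rho> by auto
    qed (use that \<rho> in \<open>auto simp: U_def dist_commute\<close>)
  qed
  \<comment> \<open>\<open>g\<close> and \<open>h\<close> agree on \<open>U\<close>, a rectangle
    that straddles the height \<open>t\<close>, so \<open>G\<close> is holomorphic across the
    seam.\<close>
  define G where "G = (\<lambda>z. if Im z < t then g z else h z)"
  have Gh: "G z = h z" if "z \<in> rect (x - \<epsilon>) (x + \<epsilon>) (max p s') d" for z
    using that gh[of z] r by (auto simp: G_def U_def mem_rect)
  have "ext G (x - \<epsilon>) (x + \<epsilon>) s'"
    unfolding ext_def
  proof (intro conjI ballI)
    show "a \<le> x - \<epsilon>" "x + \<epsilon> \<le> b" "x - \<epsilon> < x + \<epsilon>" "c \<le> s'" "s' \<le> e" using \<epsilon> pe s' se by auto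
  next
    fix z assume z: "z \<in> rect (x - \<epsilon>) (x + \<epsilon>) s' d"
    show "(G has_field_derivative F z (G z)) (at z)"
    proof (cases "Im z < t")
      case True
      have z': "z \<in> rect (x - \<epsilon>) (x + \<epsilon>) s' t" using z True by (auto simp: mem_rect)
      have "z \<in> ball z1 r" using z' s' by (intro near) (auto simp: mem_rect)
      from g(3)[OF this] have "(G has_field_derivative F z (g z)) (at z)"
        by (rule has_field_derivative_transform_within_open[OF _ open_rect z']) (auto simp: G_def mem_rect)
      then show ?thesis using True by (simp add: G_def)
    next
      case False
      have z': "z \<in> rect (x - \<epsilon>) (x + \<epsilon>) (max p s') d"
        using z False h(2) by (auto simp: mem_rect z1_def)
      then have "z \<in> rect u v p d" using \<epsilon> by (auto simp: mem_rect)
      from hd[OF this] have "(G has_field_derivative F z (h z)) (at z)"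
        by (rule has_field_derivative_transform_within_open[OF _ open_rect z']) (auto simp: Gh)
      then show ?thesis using Gh[OF z'] by simp
    qed
  next
    fix z assume z: "z \<in> rect (x - \<epsilon>) (x + \<epsilon>) e d"
    then have "z \<in> rect (x - \<epsilon>) (x + \<epsilon>) (max p s') d" using pe s' se by (auto simp: mem_rect)
    moreover have "h z = y z" using h(1) z \<epsilon> by (auto simp: ext_def mem_rect)
    ultimately show "G z = y z" using Gh by simp
  qed
  moreover have "Complex x s \<in> rect (x - \<epsilon>) (x + \<epsilon>) s' d" using \<epsilon> s' s by (auto simp: mem_rect)
  ultimately show ?thesis by (auto simp: Om_def)
qed

section \<open>Points that stop the descent, and why they are countable\<close>

definition blocked :: "complex \<Rightarrow> bool" where
  "blocked z \<longleftrightarrow> z \<in> rect a b c d \<and> z \<notin> Om \<and> (\<forall>t. Im z < t \<and> t < d \<longrightarrow> Complex (Re z) t \<in> Om)"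

lemma blocked_exists:
  assumes x: "a < x" "x < b" and s: "c < s" "s \<le> e" and nOm: "Complex x s \<notin> Om"
  obtains z where "blocked z" "Re z = x"
proof -
  define T where "T = {s..e} \<inter> (\<lambda>t. Complex x t) -` (- Om)"
  have "continuous_on {s..e} (\<lambda>t. Complex x t)"
    by (simp add: Complex_eq) (intro continuous_intros)
  then have "closed T"
    unfolding T_def using open_Om by (intro continuous_closed_preimage) auto
  moreover have "bounded T" unfolding T_def by (rule bounded_subset[of "{s..e}"]) auto
  ultimately have "compact T" by (simp add: compact_eq_bounded_closed)
  moreover have "s \<in> T" using s nOm by (simp add: T_def)
  ultimately obtain m where m: "m \<in> T" "\<And>t. t \<in> T \<Longrightarrow> t \<le> m"
    using compact_attains_sup[of T] by blast
  have "Complex x t \<in> Om" if "m < t" "t < d" for t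
  proof (cases "t \<le> e")
    case True
    have "t \<notin> T" using m(2)[of t] that by auto
    moreover have "s \<le> t" using m(1) that by (auto simp: T_def)
    ultimately show ?thesis using True by (auto simp: T_def)
  next
    case False
    then show ?thesis using top_subset_Om x that by (auto simp: mem_rect subset_iff)
  qed
  then have "blocked (Complex x m)"
    using m(1) x s ed by (auto simp: blocked_def T_def mem_rect)
  then show thesis using that by simp
qed

text \<open>Contrapositive of \<open>Om_extend\<close>: a bound at heights arbitrarily close to
  \<open>Im z\<close> would put \<open>z\<close> into \<open>Om\<close>.\<close>

lemma blocked_blowup:
  assumes "blocked z"
  shows "\<forall>\<^sub>F t in at_right (Im z). M < norm (Y (Complex (Re z) t))"
proof (rule ccontr)
  assume nev: "\<not> ?thesis"
  have z: "a < Re z" "Re z < b" "c < Im z" "Im z < d" using assms by (auto simp: blocked_def mem_rect)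
  have "Complex (Re z) (Im z) \<in> Om"
  proof (rule Om_extend[OF z])
    fix \<delta> :: real assume \<delta>: "0 < \<delta>"
    define t0 where "t0 = min d (Im z + \<delta>)"
    have "t0 > Im z" using z \<delta> by (simp add: t0_def)
    then obtain t where "Im z < t" "t < t0" "norm (Y (Complex (Re z) t)) \<le> M"
      using nev unfolding eventually_at_right_field not_less by (metis not_less)
    then show "\<exists>t>Im z. t < Im z + \<delta> \<and> t < d \<and> norm (Y (Complex (Re z) t)) \<le> M"
      by (auto simp: t0_def)
  qed (use assms in \<open>auto simp: blocked_def\<close>)
  then show False using assms by (simp add: blocked_def)
qed


text \<open>
  \<open>Z\<close> is an inverse branch of \<open>1 / Y\<close>, defined up to \<open>1 / Y = 0\<close>, where it takes the value \<open>z\<close>. The germ of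
  \<open>Y\<close> at any single point of \<open>W\<close> determines \<open>Z\<close>, and thereby \<open>z\<close>; since \<open>W\<close> meets every dense set, there are
  only countably many such \<open>z\<close>.
\<close>

definition inverse_chart :: "complex \<Rightarrow> complex set \<Rightarrow> real \<Rightarrow> (complex \<Rightarrow> complex) \<Rightarrow> bool" where
  "inverse_chart z W R Z \<longleftrightarrow> 0 < R \<and> Z holomorphic_on ball 0 R \<and> Z 0 = z \<and> open W \<and> W \<noteq> {} \<and> W \<subseteq> Om \<and>
     (\<forall>w\<in>W. Y w \<noteq> 0 \<and> norm (1 / Y w) < R \<and> Z (1 / Y w) = w)"

text \<open>\<open>Z\<close> and \<open>Z'\<close> both invert \<open>1 / Y\<close> on
  \<open>W \<inter> W'\<close>, so they agree on the image of that set. The image accumulates at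
  \<open>f w\<close> because \<open>f\<close> is continuous and injective there, and the identity
  theorem carries the agreement to 0.\<close>

lemma inverse_chart_unique:
  assumes Z: "inverse_chart z W R Z" and Z': "inverse_chart z' W' R' Z'" and w: "w \<in> W" "w \<in> W'"
  shows "z = z'"
proof -
  define f where "f = (\<lambda>w. 1 / Y w)"
  define r where "r = min R R'"
  have op: "open (W \<inter> W')" using Z Z' by (auto simp: inverse_chart_def)
  have f: "norm (f x) < r" "Z (f x) = x" "Z' (f x) = x" if "x \<in> W \<inter> W'" for x
    using Z Z' that by (auto simp: inverse_chart_def f_def r_def)
  have "w \<in> Om" "Y w \<noteq> 0" using Z w by (auto simp: inverse_chart_def)
  then have cont: "isCont f w"
    unfolding f_def using Y_deriv[THEN DERIV_isCont] by (intro continuous_intros) auto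
  have lim: "f w islimpt f ` (W \<inter> W')"
    unfolding islimpt_def
  proof (intro allI impI)
    fix T assume T: "f w \<in> T" "open T"
    obtain U where U: "open U" "w \<in> U" "\<And>x. x \<in> U \<Longrightarrow> f x \<in> T"
      using cont[unfolded continuous_at_open, rule_format, of T] T by blast
    have "open (U \<inter> (W \<inter> W'))" "w \<in> U \<inter> (W \<inter> W')" using U op w by auto
    then have "U \<inter> (W \<inter> W') \<noteq> {w}" "w \<in> U \<inter> (W \<inter> W')"
      using not_open_singleton[of w] by metis+
    then obtain x where x: "x \<in> U \<inter> (W \<inter> W')" "x \<noteq> w" by blast
    have "f x \<noteq> f w" using f(2)[of x] f(2)[of w] x w by auto
    then show "\<exists>y\<in>f ` (W \<inter> W'). y \<in> T \<and> y \<noteq> f w" using x U by blast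
  qed
  have rpos: "0 < r" using Z Z' by (auto simp: inverse_chart_def r_def)
  have "Z 0 - Z' 0 = 0"
  proof (rule analytic_continuation[where f = "\<lambda>v. Z v - Z' v" and S = "ball 0 r" and U = "f ` (W \<inter> W')" and \<xi> = "f w"])
    show "(\<lambda>v. Z v - Z' v) holomorphic_on ball 0 r"
      using Z Z' by (auto simp: inverse_chart_def r_def intro!: holomorphic_intros elim!: holomorphic_on_subset)
    show "f ` (W \<inter> W') \<subseteq> ball 0 r" "f w \<in> ball 0 r" using f(1) w by auto
  qed (use lim rpos f in auto)
  then show ?thesis using Z Z' by (auto simp: inverse_chart_def)
qed

text \<open>With \<open>v = 1 / Y\<close> as independent variable, the singularity of
  \<open>Y\<close> becomes an ordinary point. The inverted equation is solved from \<open>z1\<close>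
  just above \<open>zs\<close>, where \<open>Y\<close> is defined; at \<open>v = 0\<close> nothing
  yet ties a solution to \<open>Y\<close>. The ball about \<open>v0\<close> is arranged to contain
  0, and following the segment from \<open>z1\<close> down to \<open>zs\<close> identifies
  \<open>Z 0\<close>.\<close>

lemma blocked_inverse_chart:
  assumes bl: "blocked zs" and AN: "A N zs \<noteq> 0" and N: "2 \<le> N"
  obtains W R Z where "inverse_chart zs W R Z"
proof -
  define x s where "x = Re zs" and "s = Im zs"
  have zs: "zs = Complex x s" by (simp add: x_def s_def)
  have zsr: "zs \<in> rect a b c d" using bl by (simp add: blocked_def)
  then have sd: "s < d" by (simp add: mem_rect s_def)
  have above: "Complex x t \<in> Om" if "s < t" "t < d" for t
    using bl that by (auto simp: blocked_def x_def s_def)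
  obtain \<eta> where \<eta>: "\<eta> > 0" "cball zs \<eta> \<subseteq> rect a b c d"
    using zsr open_contains_cball open_rect by metis
  obtain C where C: "0 \<le> C"
      "\<And>k z w. \<lbrakk>k \<le> N; z \<in> cball zs \<eta>; w \<in> cball zs \<eta>\<rbrakk> \<Longrightarrow> norm (A k z - A k w) \<le> C * norm (z - w)"
    using holomorphic_family_bound_lipschitz_cball[of N A, OF A open_rect \<eta>(2)] by blast
  \<comment> \<open>The right-hand side with reversed exponents:
    \<open>q z v = v ^ N * F z (1 / v)\<close> for \<open>v \<noteq> 0\<close>, while
    \<open>v = 0\<close> gives the leading coefficient.\<close>
  define q where "q = (\<lambda>z v. \<Sum>k\<le>N. A k z * v ^ (N - k))"
  define K where "K = of_nat (Suc N) * C + 1"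
  have K: "K \<ge> 1" using C by (simp add: K_def)
  have qlip: "norm (q z v - q w v) \<le> K * norm (z - w)"
    if "z \<in> cball zs \<eta>" "w \<in> cball zs \<eta>" "norm v \<le> 1" for z w v
  proof -
    have "q z v - q w v = (\<Sum>k\<le>N. (A k z - A k w) * v ^ (N - k))"
      by (simp add: q_def sum_subtractf algebra_simps)
    also have "norm \<dots> \<le> of_nat (card {..N}) * (C * norm (z - w))"
    proof (rule sum_norm_bound)
      fix k assume "k \<in> {..N}"
      then have "norm (A k z - A k w) \<le> C * norm (z - w)" using that by (intro C) auto
      moreover have "norm (v ^ (N - k)) \<le> 1" using that by (simp add: norm_power power_le_one)
      ultimately have "norm (A k z - A k w) * norm (v ^ (N - k)) \<le> C * norm (z - w) * 1"
        using C by (intro mult_mono) auto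
      then show "norm ((A k z - A k w) * v ^ (N - k)) \<le> C * norm (z - w)" by (simp add: norm_mult)
    qed
    also have "\<dots> \<le> K * norm (z - w)" by (simp add: K_def algebra_simps)
    finally show ?thesis .
  qed
  \<comment> \<open>This half of the leading coefficient's modulus will bound \<open>q\<close> from
    below: moving \<open>z\<close> away from \<open>zs\<close> and moving \<open>v\<close> away from
    0 may each cost \<open>m / 2\<close>.\<close>
  define m where "m = norm (A N zs) / 2"
  have m: "m > 0" using AN by (simp add: m_def)
  have q0: "q zs 0 = A N zs"
  proof -
    have "q zs 0 = (\<Sum>k\<in>{N}. A k zs * 0 ^ (N - k))"
      unfolding q_def by (rule sum.mono_neutral_right) auto
    then show ?thesis by simp
  qed
  have "isCont (q zs) 0" unfolding q_def by (intro continuous_intros)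
  then obtain \<delta>0 where \<delta>0: "\<delta>0 > 0" "\<And>v. norm v < \<delta>0 \<Longrightarrow> norm (q zs v - A N zs) < m / 2"
    unfolding continuous_at_eps_delta using q0 m by (metis dist_norm diff_zero half_gt_zero)
  define \<delta> where "\<delta> = min 1 \<delta>0"
  have \<delta>: "\<delta> > 0" "\<delta> \<le> 1" "\<delta> \<le> \<delta>0" using \<delta>0 by (auto simp: \<delta>_def)
  define \<eta>1 where "\<eta>1 = min \<eta> (m / (2 * K))"
  have \<eta>1: "\<eta>1 > 0" "\<eta>1 \<le> \<eta>" using \<eta> m K by (auto simp: \<eta>1_def)
  have K\<eta>1: "K * \<eta>1 \<le> m / 2" using mult_left_mono[of \<eta>1 "m / (2 * K)" K] K by (simp add: \<eta>1_def)
  have sub1: "cball zs \<eta>1 \<subseteq> cball zs \<eta>" using \<eta>1 by auto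
  have qm: "m \<le> norm (q z v)" if "z \<in> cball zs \<eta>1" "norm v < \<delta>" for z v
  proof -
    have "norm (q z v - q zs v) \<le> K * norm (z - zs)"
      using that sub1 \<delta> \<eta> by (intro qlip) auto
    also have "\<dots> \<le> K * \<eta>1" using that K by (intro mult_left_mono) (auto simp: dist_norm norm_minus_commute)
    finally have 1: "norm (q z v - q zs v) \<le> m / 2" using K\<eta>1 by simp
    have 2: "norm (q zs v - A N zs) < m / 2" using that \<delta> by (intro \<delta>0) auto
    have "norm (A N zs) \<le> norm (q z v) + norm (q z v - q zs v) + norm (q zs v - A N zs)"
      by norm
    then show ?thesis using 1 2 by (simp add: m_def)
  qed
  txt \<open>For \<open>v = 1 / Y\<close> the equation reads \<open>dv / dz = - q z v / v\<^sup>N\<^sup>-\<^sup>2\<close>, so the inverse function solves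
    \<open>dz / dv = G v z\<close>, which is regular at \<open>v = 0\<close>.\<close>
  define G where "G = (\<lambda>v z. - (v ^ (N - 2)) / q z v)"
  have Gbd: "norm (G v z) \<le> 1 / m" if "z \<in> cball zs \<eta>1" "norm v < \<delta>" for z v
  proof -
    have "norm (v ^ (N - 2)) \<le> 1" using that \<delta> by (simp add: norm_power power_le_one)
    then show ?thesis
      unfolding G_def norm_divide norm_minus_cancel
      using qm[OF that] m by (intro frac_le) auto
  qed
  have Glip: "norm (G v z - G v w) \<le> K / m\<^sup>2 * norm (z - w)"
    if "z \<in> cball zs \<eta>1" "w \<in> cball zs \<eta>1" "norm v < \<delta>" for z w v
  proof -
    have nz: "q z v \<noteq> 0" "q w v \<noteq> 0" using qm[OF that(1,3)] qm[OF that(2,3)] m by auto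
    have v1: "norm (v ^ (N - 2)) \<le> 1" using that \<delta> by (simp add: norm_power power_le_one)
    have "G v z - G v w = v ^ (N - 2) * (q z v - q w v) / (q z v * q w v)"
      using nz by (simp add: G_def field_simps)
    then have "norm (G v z - G v w) = norm (v ^ (N - 2)) * norm (q z v - q w v) / (norm (q z v) * norm (q w v))"
      by (simp add: norm_mult norm_divide)
    also have "\<dots> \<le> (1 * (K * norm (z - w))) / (m * m)"
    proof (rule frac_le)
      show "norm (v ^ (N - 2)) * norm (q z v - q w v) \<le> 1 * (K * norm (z - w))"
        using that sub1 \<delta> v1 by (intro mult_mono qlip) auto
      show "m * m \<le> norm (q z v) * norm (q w v)"
        using that m by (intro mult_mono qm) auto
    qed (use m K in auto)
    finally show ?thesis by (simp add: power2_eq_square)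
  qed
  \<comment> \<open>In turn: \<open>norm v < \<delta>\<close> on the ball about \<open>v0\<close>;
    Picard's values stay within \<open>\<eta>1 / 2\<close> of \<open>z1\<close>; Picard's map
    contracts by 1/2.\<close>
  define r where "r = min (\<delta> / 2) (min (m * \<eta>1 / 2) (m\<^sup>2 / (2 * K)))"
  have r: "r > 0" "r \<le> \<delta> / 2" using \<delta> m \<eta>1 K by (auto simp: r_def)
  have "r \<le> m * \<eta>1 / 2" "r \<le> m\<^sup>2 / (2 * K)" by (auto simp: r_def)
  then have r2: "1 / m * r \<le> \<eta>1 / 2" "K / m\<^sup>2 * r \<le> 1 / 2" using m K by (auto simp: field_simps)
  have blow: "\<forall>\<^sub>F t in at_right s. M < norm (Y (Complex x t))" for M
    using blocked_blowup[OF bl] by (simp add: x_def s_def)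
  \<comment> \<open>Here \<open>norm (1 / Y) < r / 2\<close>, so the ball of radius \<open>r\<close>
    about \<open>v0\<close> contains 0 and all values of \<open>1 / Y\<close> on
    \<open>U\<close>.\<close>
  obtain t1 where t1: "s < t1" "\<And>t. \<lbrakk>s < t; t < t1\<rbrakk> \<Longrightarrow> 2 / r < norm (Y (Complex x t))"
    using blow[of "2 / r"] unfolding eventually_at_right_field by blast
  define t0 where "t0 = (s + min t1 (min d (s + \<eta>1 / 2))) / 2"
  have t0: "s < t0" "t0 < t1" "t0 < d" "t0 < s + \<eta>1 / 2"
    using t1(1) sd \<eta>1(1) unfolding t0_def by (auto simp: min_def field_simps)
  define z1 where "z1 = Complex x t0"
  define U where "U = Om \<inter> Y -` {w. 2 / r < norm w}"
  have opU: "open U"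
    unfolding U_def
    using Y_holomorphic open_Om
    by (intro continuous_open_preimage holomorphic_on_imp_continuous_on)
       (auto intro!: open_Collect_less continuous_intros)
  have U: "u \<in> Om" "Y u \<noteq> 0" "norm (1 / Y u) < r / 2" if "u \<in> U" for u
  proof -
    have *: "2 / r < norm (Y u)" using that by (simp add: U_def)
    then have "0 < norm (Y u)" using r by (meson divide_pos_pos less_trans zero_less_numeral)
    then show "Y u \<noteq> 0" by auto
    show "norm (1 / Y u) < r / 2" using * r \<open>0 < norm (Y u)\<close> by (simp add: norm_divide field_simps)
    show "u \<in> Om" using that by (simp add: U_def)
  qed
  have segU: "Complex x t \<in> U" if "s < t" "t \<le> t0" for t
    using t1(2)[of t] above[of t] that t0 by (auto simp: U_def)
  have z1U: "z1 \<in> U" using segU t0 by (simp add: z1_def)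
  have dz1: "dist zs z1 < \<eta>1 / 2" using t0 by (simp add: zs z1_def dist_norm cmod_def)
  define v0 where "v0 = 1 / Y z1"
  have v0: "norm v0 < r / 2" using U(3)[OF z1U] by (simp add: v0_def)
  have b1: "norm v < \<delta>" if "v \<in> ball v0 r" for v
  proof -
    have "norm v \<le> norm v0 + norm (v0 - v)" by norm
    also have "\<dots> < r / 2 + r" using that v0 by (auto simp: dist_norm)
    finally show ?thesis using r \<delta> by linarith
  qed
  have b2: "cball z1 (\<eta>1 / 2) \<subseteq> cball zs \<eta>1"
  proof
    fix z assume "z \<in> cball z1 (\<eta>1 / 2)"
    then show "z \<in> cball zs \<eta>1" using dz1 dist_triangle[of zs z z1] by auto
  qed
  obtain Z where Z: "Z ` ball v0 r \<subseteq> cball z1 (\<eta>1 / 2)" "Z v0 = z1"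
      "\<And>v. v \<in> ball v0 r \<Longrightarrow> (Z has_field_derivative G v (Z v)) (at v)"
  proof (rule complex_picard[of r "\<eta>1 / 2" v0 z1 G "1 / m" "K / m\<^sup>2"])
    fix g assume g: "g holomorphic_on ball v0 r" "g ` ball v0 r \<subseteq> cball z1 (\<eta>1 / 2)"
    have gs: "g v \<in> cball zs \<eta>1" if "v \<in> ball v0 r" for v using g(2) b2 that by blast
    have "(\<lambda>v. A k (g v)) holomorphic_on ball v0 r" if "k \<le> N" for k
      using holomorphic_on_compose_gen[OF g(1) A[OF that]] gs sub1 \<eta>(2) unfolding o_def by blast
    then have "(\<lambda>v. q (g v) v) holomorphic_on ball v0 r"
      unfolding q_def by (intro holomorphic_intros) auto
    moreover have "q (g v) v \<noteq> 0" if "v \<in> ball v0 r" for v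
      using qm[OF gs[OF that] b1[OF that]] m by auto
    ultimately show "(\<lambda>v. G v (g v)) holomorphic_on ball v0 r"
      unfolding G_def by (intro holomorphic_intros)
  next
    show "norm (G v z) \<le> 1 / m" if "v \<in> ball v0 r" "z \<in> cball z1 (\<eta>1 / 2)" for v z
      using that b1 b2 by (intro Gbd) blast+
    show "norm (G v z - G v w) \<le> K / m\<^sup>2 * norm (z - w)"
      if "v \<in> ball v0 r" "z \<in> cball z1 (\<eta>1 / 2)" "w \<in> cball z1 (\<eta>1 / 2)" for v z w
      using that b1 b2 by (intro Glip) blast+
  qed (use r r2 \<eta>1 that in auto)
  have Zh: "Z holomorphic_on ball v0 r"
    by (rule holomorphic_onI) (meson Z(3) field_differentiable_at_within field_differentiable_def)
  have inb: "1 / Y u \<in> ball v0 r" if "u \<in> U" for u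
  proof -
    have "norm (v0 - 1 / Y u) \<le> norm v0 + norm (1 / Y u)" by (rule norm_triangle_ineq4)
    also have "\<dots> < r / 2 + r / 2" using v0 U(3)[OF that] by (intro add_strict_mono)
    finally show ?thesis by (simp add: dist_norm)
  qed
  \<comment> \<open>With \<open>w = Z (1 / Y z)\<close>, the derivative of \<open>w - z\<close> is
    \<open>q z v / q w v - 1\<close>, of modulus at most \<open>K / m * norm (w - z)\<close>, and
    \<open>w = z\<close> at \<open>z1\<close>.\<close>
  have near: "\<forall>\<^sub>F z in nhds z1. Z (1 / Y z) - z = 0"
  proof -
    have "open (U \<inter> ball zs \<eta>1)" "z1 \<in> U \<inter> ball zs \<eta>1" using opU z1U dz1 \<eta>1 by auto
    then obtain \<rho> where \<rho>: "\<rho> > 0" "ball z1 \<rho> \<subseteq> U \<inter> ball zs \<eta>1" using openE by blast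
    show ?thesis
    proof (rule eventually_zero_if_deriv_bound[where r = \<rho> and L = "K / m"])
      fix z assume "z \<in> ball z1 \<rho>"
      then have zU: "z \<in> U" and zc: "z \<in> cball zs \<eta>1" using \<rho> by auto
      define v where "v = 1 / Y z"
      define w where "w = Z v"
      have v: "v \<in> ball v0 r" "v \<noteq> 0" "norm v < \<delta>" using inb[OF zU] U(2)[OF zU] b1 by (auto simp: v_def)
      have wc: "w \<in> cball zs \<eta>1" using Z(1) b2 v(1) unfolding w_def by blast
      have nz: "q z v \<noteq> 0" "q w v \<noteq> 0" using qm[OF zc v(3)] qm[OF wc v(3)] m by auto
      have "F z (Y z) = q z v / v ^ N"
      proof -
        have "A k z * Y z ^ k = A k z * v ^ (N - k) / v ^ N" if "k \<le> N" for k
        proof -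
          have "v ^ N = v ^ (N - k) * v ^ k" using that by (simp flip: power_add)
          moreover have "Y z = 1 / v" by (simp add: v_def)
          ultimately show ?thesis using v(2) by (simp add: power_divide)
        qed
        then show ?thesis by (simp add: F_def q_def sum_divide_distrib)
      qed
      moreover have "((\<lambda>z. 1 / Y z) has_field_derivative - (F z (Y z)) * v\<^sup>2) (at z)"
        using Y_deriv[OF U(1)[OF zU]] U(2)[OF zU]
        by (auto intro!: derivative_eq_intros simp: v_def power2_eq_square)
      ultimately have dv: "((\<lambda>z. 1 / Y z) has_field_derivative - (q z v / v ^ N) * v\<^sup>2) (at z)" by simp
      have "((\<lambda>z. Z (1 / Y z)) has_field_derivative G v w * (- (q z v / v ^ N) * v\<^sup>2)) (at z)"
        using DERIV_chain2[OF _ dv, of Z "G v w"] Z(3)[OF v(1)] by (simp add: v_def w_def)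
      moreover have "G v w * (- (q z v / v ^ N) * v\<^sup>2) = q z v / q w v"
      proof -
        have "v ^ N = v ^ (N - 2) * v\<^sup>2" using N by (metis le_add_diff_inverse2 power_add)
        then show ?thesis using v(2) nz by (simp add: G_def field_simps)
      qed
      ultimately show "((\<lambda>z. Z (1 / Y z) - z) has_field_derivative (q z v / q w v - 1)) (at z)"
        by (auto intro!: derivative_eq_intros)
      have "q z v / q w v - 1 = (q z v - q w v) / q w v" using nz by (simp add: field_simps)
      then have "norm (q z v / q w v - 1) = norm (q z v - q w v) / norm (q w v)" by (simp add: norm_divide)
      also have "\<dots> \<le> (K * norm (z - w)) / m"
        using qm[OF wc v(3)] m zc wc sub1 v(3) \<delta> K by (intro frac_le qlip) auto
      finally show "norm (q z v / q w v - 1) \<le> K / m * norm (Z (1 / Y z) - z)"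
        by (simp add: w_def v_def norm_minus_commute)
    qed (use \<rho> Z in \<open>auto simp: v0_def\<close>)
  qed
  \<comment> \<open>A connected set that contains the segment from \<open>z1\<close> down towards
    \<open>zs\<close>, so that \<open>Z (1 / Y w) = w\<close> spreads all the way down.\<close>
  define W where "W = connected_component_set U z1"
  have W: "open W" "connected W" "W \<subseteq> U" "z1 \<in> W"
    using opU z1U by (auto simp: W_def open_connected_component connected_component_subset)
  have hol: "(\<lambda>z. Z (1 / Y z)) holomorphic_on W"
  proof -
    have "(\<lambda>z. 1 / Y z) holomorphic_on W"
      using W(3) U Y_holomorphic
      by (intro holomorphic_intros) (auto elim!: holomorphic_on_subset)
    from holomorphic_on_compose_gen[OF this Zh] show ?thesis using inb W(3) unfolding o_def by blast
  qed
  have ZW: "Z (1 / Y w) = w" if "w \<in> W" for w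
  proof -
    obtain \<rho> where \<rho>: "\<rho> > 0" "\<And>z. dist z z1 < \<rho> \<Longrightarrow> Z (1 / Y z) = z"
      using near by (auto simp: eventually_nhds_metric)
    show ?thesis
    proof (rule analytic_continuation_open[of "W \<inter> ball z1 \<rho>" W "\<lambda>z. Z (1 / Y z)" "\<lambda>z. z"])
      show "W \<inter> ball z1 \<rho> \<noteq> {}" using W(4) \<rho> by auto
    qed (use W \<rho> hol that in \<open>auto simp: dist_commute\<close>)
  qed
  have segW: "Complex x t \<in> W" if "s < t" "t \<le> t0" for t
  proof -
    have "connected ((\<lambda>t. Complex x t) ` {s<..t0})"
      by (intro connected_continuous_image) (auto simp: Complex_eq intro!: continuous_intros)
    then have "(\<lambda>t. Complex x t) ` {s<..t0} \<subseteq> W"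
      unfolding W_def using t0 segU by (intro connected_component_maximal) (auto simp: z1_def)
    then show ?thesis using that by auto
  qed
  \<comment> \<open>Let \<open>t\<close> decrease to \<open>s\<close> in
    \<open>Z (1 / Y) = id\<close>; by the blow-up, \<open>1 / Y\<close> tends to 0.\<close>
  have "Z 0 = zs"
  proof (rule tendsto_unique[where F = "at_right s"])
    have "((\<lambda>t. 1 / Y (Complex x t)) \<longlongrightarrow> 0) (at_right s)"
    proof (rule tendstoI)
      fix \<epsilon> :: real assume \<epsilon>: "\<epsilon> > 0"
      show "\<forall>\<^sub>F t in at_right s. dist (1 / Y (Complex x t)) 0 < \<epsilon>"
        using blow[of "1 / \<epsilon>"]
      proof eventually_elim
        case (elim t)
        then have "0 < norm (Y (Complex x t))" using \<epsilon> by (meson divide_pos_pos less_trans zero_less_one)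
        then show ?case using elim \<epsilon> by (simp add: norm_divide field_simps)
      qed
    qed
    moreover have "isCont Z 0"
      using Z(3)[of 0] v0 r by (intro DERIV_isCont) (auto simp: dist_norm)
    ultimately have "((\<lambda>t. Z (1 / Y (Complex x t))) \<longlongrightarrow> Z 0) (at_right s)"
      by (rule isCont_tendsto_compose[rotated])
    moreover have "\<forall>\<^sub>F t in at_right s. Z (1 / Y (Complex x t)) = Complex x t"
      using t0 segW ZW unfolding eventually_at_right_field by (intro exI[of _ t0]) auto
    ultimately show "((\<lambda>t. Complex x t) \<longlongrightarrow> Z 0) (at_right s)"
      by (rule Lim_transform_eventually)
    show "((\<lambda>t. Complex x t) \<longlongrightarrow> zs) (at_right s)"
      unfolding zs by (auto simp: Complex_eq intro!: tendsto_intros)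
  qed simp
  moreover have "Z holomorphic_on ball 0 (r / 2)"
  proof (rule holomorphic_on_subset[OF Zh])
    show "ball 0 (r / 2) \<subseteq> ball v0 r"
    proof
      fix v :: complex assume "v \<in> ball 0 (r / 2)"
      then have "norm v < r / 2" by simp
      then have "norm (v0 - v) < r" using v0 norm_triangle_ineq4[of v0 v] by linarith
      then show "v \<in> ball v0 r" by (simp add: dist_norm)
    qed
  qed
  ultimately have "inverse_chart zs W (r / 2) Z"
    unfolding inverse_chart_def using W U ZW r by auto
  then show thesis by (rule that)
qed

text \<open>Blocked points with \<open>A N z = 0\<close> are beyond the reach of the charts; as
  zeros of a nonzero holomorphic function on a connected set they are countable too.\<close>

lemma countable_blocked:
  assumes N: "2 \<le> N" and nz: "\<exists>z\<in>rect a b c d. A N z \<noteq> 0"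
  shows "countable {z. blocked z}"
proof -
  obtain D :: "complex set" where D: "countable D" "\<And>X. \<lbrakk>open X; X \<noteq> {}\<rbrakk> \<Longrightarrow> \<exists>d\<in>D. d \<in> X"
    using countable_dense_setE by metis
  define B where "B = (\<lambda>w. {z. \<exists>W R Z. inverse_chart z W R Z \<and> w \<in> W})"
  have "countable (B w)" for w
  proof -
    have "z = z'" if "z \<in> B w" "z' \<in> B w" for z z'
      using that inverse_chart_unique unfolding B_def by blast
    then have "B w = {} \<or> (\<exists>z. B w = {z})" by blast
    then show ?thesis by auto
  qed
  then have "countable (\<Union>w\<in>D. B w)" using D(1) by simp
  moreover have "countable {z \<in> rect a b c d. A N z = 0}"
  proof -
    have "{z \<in> rect a b c d. A N z = 0} sparse_in rect a b c d"
      using holomorphic_zeros_sparse[OF A[of N] open_rect connected_rect] nz by auto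
    from sparse_imp_countable[OF open_rect this] show ?thesis by (simp add: Int_def)
  qed
  moreover have "{z. blocked z} \<subseteq> (\<Union>w\<in>D. B w) \<union> {z \<in> rect a b c d. A N z = 0}"
  proof
    fix z assume "z \<in> {z. blocked z}"
    then have bl: "blocked z" by simp
    show "z \<in> (\<Union>w\<in>D. B w) \<union> {z \<in> rect a b c d. A N z = 0}"
    proof (cases "A N z = 0")
      case True
      then show ?thesis using bl by (auto simp: blocked_def)
    next
      case False
      then obtain W R Z where W: "inverse_chart z W R Z" using blocked_inverse_chart[OF bl _ N] by blast
      then obtain w where "w \<in> D" "w \<in> W" using D(2)[of W] by (auto simp: inverse_chart_def)
      then show ?thesis using W by (auto simp: B_def)
    qed
  qed
  ultimately show ?thesis by (meson countable_Un countable_subset)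
qed

text \<open>\<open>c'\<close> is strictly above \<open>c\<close> because a point of height
  \<open>c'\<close> must lie inside an open rectangle whose bottom is at least
  \<open>c\<close>.\<close>

lemma continuation_exists:
  assumes N: "2 \<le> N" and nz: "\<exists>z\<in>rect a b c d. A N z \<noteq> 0" and c': "c < c'" "c' \<le> e"
  shows "\<exists>u v g. a \<le> u \<and> u < v \<and> v \<le> b \<and> g holomorphic_on rect u v c' d \<and> (\<forall>z\<in>rect u v e d. g z = y z)"
proof -
  have "\<exists>x\<in>{a<..<b}. Complex x c' \<in> Om"
  proof (rule ccontr)
    assume "\<not> ?thesis"
    then have "x \<in> Re ` {z. blocked z}" if "x \<in> {a<..<b}" for x
      using blocked_exists[of x c'] c' that by (metis greaterThanLessThan_iff imageI mem_Collect_eq)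
    then have "countable {a<..<b}"
      using countable_blocked[OF N nz] by (meson countable_image countable_subset subsetI)
    then show False using uncountable_open_interval[of a b] ab by simp
  qed
  then obtain x g u v s where g: "ext g u v s" "Complex x c' \<in> rect u v s d" by (auto simp: Om_def)
  then have "g holomorphic_on rect u v c' d"
    using ext_holomorphic[OF g(1)] by (auto simp: mem_rect elim!: holomorphic_on_subset)
  then show ?thesis using g(1) unfolding ext_def by blast
qed

end

section \<open>Extending a solution of one polynomial equation\<close>

lemma holomorphic_onI_deriv:
  assumes "\<And>z. z \<in> S \<Longrightarrow> (f has_field_derivative f' z) (at z)"
  shows "f holomorphic_on S"
  using assms by (meson field_differentiable_at_within field_differentiable_def holomorphic_onI)

text \<open>Integrating factor: with \<open>B' = A1\<close>, the function
  \<open>y * exp (- B)\<close> has derivative \<open>A0 * exp (- B)\<close>, which has a primitive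
  on the whole rectangle. A linear equation thus costs no width.\<close>

lemma linear_extension:
  assumes A0: "A0 holomorphic_on rect a b c d" and A1: "A1 holomorphic_on rect a b c d" and ce: "c < e"
    and y: "\<And>z. z \<in> rect a b e d \<Longrightarrow> (y has_field_derivative A0 z + A1 z * y z) (at z)"
  obtains g where "g holomorphic_on rect a b c d" "\<And>z. z \<in> rect a b e d \<Longrightarrow> g z = y z"
proof -
  have sub: "rect a b e d \<subseteq> rect a b c d" using ce by (auto simp: mem_rect)
  obtain B where B: "\<And>z. z \<in> rect a b c d \<Longrightarrow> (B has_field_derivative A1 z) (at z)"
    using holomorphic_convex_primitive'[OF convex_rect open_rect A1] by (auto simp: at_within_open[OF _ open_rect])
  have Bh: "B holomorphic_on rect a b c d" using B by (rule holomorphic_onI_deriv)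
  have A0B: "(\<lambda>z. A0 z * exp (- B z)) holomorphic_on rect a b c d"
    using A0 Bh by (intro holomorphic_intros)
  obtain K where K: "\<And>z. z \<in> rect a b c d \<Longrightarrow> (K has_field_derivative A0 z * exp (- B z)) (at z)"
    using holomorphic_convex_primitive'[OF convex_rect open_rect A0B]
    by (auto simp: at_within_open[OF _ open_rect])
  have Kh: "K holomorphic_on rect a b c d" using K by (rule holomorphic_onI_deriv)
  have "((\<lambda>z. y z * exp (- B z) - K z) has_field_derivative 0) (at z within rect a b e d)"
    if "z \<in> rect a b e d" for z
  proof -
    have z: "z \<in> rect a b c d" using sub that by blast
    have "((\<lambda>z. y z * exp (- B z) - K z) has_field_derivative
           (A0 z + A1 z * y z) * exp (- B z) + (exp (- B z) * - A1 z) * y z - A0 z * exp (- B z)) (at z)"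
      by (intro DERIV_diff DERIV_mult y that K z DERIV_chain2[OF DERIV_exp] DERIV_minus B)
    then show ?thesis by (simp add: algebra_simps has_field_derivative_at_within)
  qed
  then obtain C where C: "\<And>z. z \<in> rect a b e d \<Longrightarrow> y z * exp (- B z) - K z = C"
    using has_field_derivative_zero_constant[OF convex_rect,
        of a b e d "\<lambda>z. y z * exp (- B z) - K z"] by blast
  show thesis
  proof (rule that[of "\<lambda>z. (K z + C) * exp (B z)"])
    show "(\<lambda>z. (K z + C) * exp (B z)) holomorphic_on rect a b c d"
      using Kh Bh by (intro holomorphic_intros)
    show "(K z + C) * exp (B z) = y z" if "z \<in> rect a b e d" for z
      using C[OF that] by (auto simp: exp_minus field_simps)
  qed
qed

text \<open>The count of blocked points asks for a top coefficient that is not identically zero, at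
  an index of at least 2 (the inverted equation contains \<open>v ^ (N - 2)\<close>). The sum is
  therefore cut at the largest such index; if there is none, the equation is linear.\<close>

lemma polynomial_ode_extension:
  assumes ab: "a < b" and ce: "c < e" and ed: "e < d"
    and A: "\<And>k. k \<le> N \<Longrightarrow> A k holomorphic_on rect a b c d"
    and y: "\<And>z. z \<in> rect a b e d \<Longrightarrow> (y has_field_derivative (\<Sum>k\<le>N. A k z * y z ^ k)) (at z)"
    and c': "c < c'" "c' \<le> e"
  shows "\<exists>u v g. a \<le> u \<and> u < v \<and> v \<le> b \<and> g holomorphic_on rect u v c' d \<and> (\<forall>z\<in>rect u v e d. g z = y z)"
proof -
  define S where "S = {k. k \<le> N \<and> 2 \<le> k \<and> (\<exists>z\<in>rect a b c d. A k z \<noteq> 0)}"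
  have finS: "finite S" unfolding S_def by simp
  have sub: "rect a b e d \<subseteq> rect a b c d" using ce by (auto simp: mem_rect)
  show ?thesis
  proof (cases "S = {}")
    case True
    \<comment> \<open>For \<open>N = 0\<close> nothing is assumed about \<open>A 1\<close>; the zero
      function replaces it.\<close>
    define A1 where "A1 = (if 1 \<le> N then A 1 else (\<lambda>_. 0))"
    have "(\<Sum>k\<le>N. A k z * y z ^ k) = A 0 z + A1 z * y z" if z: "z \<in> rect a b c d" for z
    proof -
      have "(\<Sum>k\<le>N. A k z * y z ^ k) = (\<Sum>k\<in>{0..min N 1}. A k z * y z ^ k)"
      proof (rule sum.mono_neutral_right)
        show "\<forall>k\<in>{..N} - {0..min N 1}. A k z * y z ^ k = 0"
        proof
          fix k assume "k \<in> {..N} - {0..min N 1}"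
          moreover have "k \<notin> S" using True by simp
          ultimately show "A k z * y z ^ k = 0" using z by (auto simp: S_def)
        qed
      qed auto
      also have "\<dots> = A 0 z + A1 z * y z"
      proof -
        consider "N = 0" | "min N 1 = Suc 0" "1 \<le> N" by linarith
        then show ?thesis by cases (simp_all add: A1_def)
      qed
      finally show ?thesis .
    qed
    then have "(y has_field_derivative A 0 z + A1 z * y z) (at z)" if "z \<in> rect a b e d" for z
      using y[OF that] sub that by auto
    moreover have "A1 holomorphic_on rect a b c d" using A by (auto simp: A1_def)
    ultimately obtain g where g: "g holomorphic_on rect a b c d" "\<And>z. z \<in> rect a b e d \<Longrightarrow> g z = y z"
      using linear_extension[OF A[of 0] _ ce, of A1 y] by auto
    have "g holomorphic_on rect a b c' d"
      by (rule holomorphic_on_subset[OF g(1)]) (use c' in \<open>auto simp: mem_rect\<close>)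
    then show ?thesis using ab g(2) by blast
  next
    case False
    define M where "M = Max S"
    have "M \<in> S" using Max_in[OF finS False] by (simp add: M_def)
    then have M: "M \<le> N" "2 \<le> M" "\<exists>z\<in>rect a b c d. A M z \<noteq> 0" by (auto simp: S_def)
    have "(\<Sum>k\<le>N. A k z * y z ^ k) = (\<Sum>k\<le>M. A k z * y z ^ k)" if z: "z \<in> rect a b c d" for z
    proof (rule sum.mono_neutral_right)
      show "\<forall>k\<in>{..N} - {..M}. A k z * y z ^ k = 0"
      proof
        fix k assume k: "k \<in> {..N} - {..M}"
        then have "k \<notin> S" using Max_ge[OF finS, of k] by (auto simp: M_def)
        then show "A k z * y z ^ k = 0" using k M z by (auto simp: S_def)
      qed
    qed (use M in auto)
    then have yM: "(y has_field_derivative (\<Sum>k\<le>M. A k z * y z ^ k)) (at z)" if "z \<in> rect a b e d" for z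
      using y[OF that] sub that by auto
    interpret vertical_continuation a b c d e M A y
      using ab ce ed A M yM by unfold_locales auto
    show ?thesis by (rule continuation_exists[OF M(2,3) c'])
  qed
qed

section \<open>Continuation of Pfaffian chains\<close>

text \<open>Sorting the monomials by their exponent at \<open>i\<close> produces the form that
  \<open>polynomial_ode_extension\<close> expects.\<close>

lemma cpoly_eval_collect:
  assumes N: "\<And>m. m \<in> Poly_Mapping.keys p \<Longrightarrow> Poly_Mapping.lookup m i \<le> N"
  shows "cpoly_eval p x =
    (\<Sum>k\<le>N. (\<Sum>m | m \<in> Poly_Mapping.keys p \<and> Poly_Mapping.lookup m i = k.
        Poly_Mapping.lookup p m * (\<Prod>v \<in> Poly_Mapping.keys m - {i}. x v ^ Poly_Mapping.lookup m v)) * x i ^ k)"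
proof -
  have "(\<Prod>v \<in> Poly_Mapping.keys m. x v ^ Poly_Mapping.lookup m v) =
      (\<Prod>v \<in> Poly_Mapping.keys m - {i}. x v ^ Poly_Mapping.lookup m v) * x i ^ Poly_Mapping.lookup m i" for m
    by (cases "i \<in> Poly_Mapping.keys m") (auto simp: prod.remove mult.commute in_keys_iff)
  then have "cpoly_eval p x = (\<Sum>m \<in> Poly_Mapping.keys p. Poly_Mapping.lookup p m *
      (\<Prod>v \<in> Poly_Mapping.keys m - {i}. x v ^ Poly_Mapping.lookup m v) * x i ^ Poly_Mapping.lookup m i)"
    by (simp add: cpoly_eval_def mult.assoc)
  also have "\<dots> = (\<Sum>k\<le>N. \<Sum>m | m \<in> Poly_Mapping.keys p \<and> Poly_Mapping.lookup m i = k.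
      Poly_Mapping.lookup p m *
      (\<Prod>v \<in> Poly_Mapping.keys m - {i}. x v ^ Poly_Mapping.lookup m v) * x i ^ Poly_Mapping.lookup m i)"
    by (rule sum.group[symmetric]) (use N in auto)
  also have "\<dots> = (\<Sum>k\<le>N. (\<Sum>m | m \<in> Poly_Mapping.keys p \<and> Poly_Mapping.lookup m i = k.
        Poly_Mapping.lookup p m * (\<Prod>v \<in> Poly_Mapping.keys m - {i}. x v ^ Poly_Mapping.lookup m v)) * x i ^ k)"
    by (intro sum.cong refl) (auto simp: sum_distrib_right intro!: sum.cong)
  finally show ?thesis .
qed

lemma holomorphic_on_chain_point:
  assumes "\<And>i. i \<in> {1..l} \<Longrightarrow> G i holomorphic_on S" "v \<le> l"
  shows "(\<lambda>z. chain_point G z v) holomorphic_on S"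
  using assms by (cases "v = 0") (auto simp: chain_point_def)

lemma holomorphic_on_cpoly_eval:
  assumes "\<And>i. i \<in> {1..l} \<Longrightarrow> G i holomorphic_on S" "cpoly_vars P \<subseteq> {0..l}"
  shows "(\<lambda>z. cpoly_eval P (chain_point G z)) holomorphic_on S"
  unfolding cpoly_eval_def
  using assms
  by (intro holomorphic_intros holomorphic_on_chain_point[of l]) (auto simp: cpoly_vars_def)

text \<open>The chain is triangular: the equation of \<open>f (Suc l)\<close> is polynomial in
  \<open>f (Suc l)\<close>, with coefficients built from functions already extended. The induction
  varies \<open>c\<close>, since those functions are first brought down to \<open>c - 1\<close>,
  which leaves the strict gap that the next extension needs.\<close>

lemma pfaffian_chain_extension:
  assumes ab: "a < b" and ed: "e < d"
    and vars: "\<And>i. i \<in> {1..l} \<Longrightarrow> cpoly_vars (p i) \<subseteq> {0..i}"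
    and f: "\<And>i z. \<lbrakk>i \<in> {1..l}; z \<in> rect a b e d\<rbrakk>
              \<Longrightarrow> (f i has_field_derivative cpoly_eval (p i) (chain_point f z)) (at z)"
    and "c < e"
  shows "\<exists>u v G. a \<le> u \<and> u < v \<and> v \<le> b \<and>
     (\<forall>i\<in>{1..l}. G i holomorphic_on rect u v c d \<and> (\<forall>z\<in>rect u v e d. G i z = f i z))"
  using vars f \<open>c < e\<close>
proof (induction l arbitrary: c)
  case 0
  then show ?case using ab by auto
next
  case (Suc l)
  have "\<exists>u v G. a \<le> u \<and> u < v \<and> v \<le> b \<and>
     (\<forall>i\<in>{1..l}. G i holomorphic_on rect u v (c - 1) d \<and> (\<forall>z\<in>rect u v e d. G i z = f i z))"
    using Suc.prems by (intro Suc.IH) auto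
  then obtain u v G where uv: "a \<le> u" "u < v" "v \<le> b"
    and G: "\<And>i. i \<in> {1..l} \<Longrightarrow> G i holomorphic_on rect u v (c - 1) d"
      "\<And>i z. \<lbrakk>i \<in> {1..l}; z \<in> rect u v e d\<rbrakk> \<Longrightarrow> G i z = f i z"
    by blast
  define q where "q = p (Suc l)"
  define N where "N = (\<Sum>m\<in>Poly_Mapping.keys q. Poly_Mapping.lookup m (Suc l))"
  have N: "Poly_Mapping.lookup m (Suc l) \<le> N" if "m \<in> Poly_Mapping.keys q" for m
    unfolding N_def using that by (intro member_le_sum) auto
  define A where "A = (\<lambda>k z. \<Sum>m | m \<in> Poly_Mapping.keys q \<and> Poly_Mapping.lookup m (Suc l) = k.
      Poly_Mapping.lookup q m * (\<Prod>v \<in> Poly_Mapping.keys m - {Suc l}. chain_point G z v ^ Poly_Mapping.lookup m v))"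
  have vq: "v \<le> l" if "m \<in> Poly_Mapping.keys q" "v \<in> Poly_Mapping.keys m - {Suc l}" for m v
  proof -
    have "v \<in> cpoly_vars q" using that by (auto simp: cpoly_vars_def)
    then show ?thesis using Suc.prems(1)[of "Suc l"] that by (auto simp: q_def)
  qed
  have Ah: "A k holomorphic_on rect u v (c - 1) d" for k
    unfolding A_def using G vq by (intro holomorphic_intros holomorphic_on_chain_point[of l]) auto
  have deriv: "(f (Suc l) has_field_derivative (\<Sum>k\<le>N. A k z * f (Suc l) z ^ k)) (at z)"
    if z: "z \<in> rect u v e d" for z
  proof -
    have "chain_point G z w = chain_point f z w" if "w \<le> l" for w
      using G(2)[of w z] z that by (auto simp: chain_point_def)
    then have "A k z = (\<Sum>m | m \<in> Poly_Mapping.keys q \<and> Poly_Mapping.lookup m (Suc l) = k.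
      Poly_Mapping.lookup q m * (\<Prod>v \<in> Poly_Mapping.keys m - {Suc l}. chain_point f z v ^ Poly_Mapping.lookup m v))" for k
      unfolding A_def using vq by (intro sum.cong prod.cong refl arg_cong2[where f = "(*)"] arg_cong2[where f = "(^)"]) auto
    then have "cpoly_eval q (chain_point f z) = (\<Sum>k\<le>N. A k z * chain_point f z (Suc l) ^ k)"
      using cpoly_eval_collect[of q "Suc l" N "chain_point f z"] N by simp
    moreover have "z \<in> rect a b e d" using z uv by (auto simp: mem_rect)
    ultimately show ?thesis
      using Suc.prems(2)[of "Suc l" z] unfolding q_def by (simp add: chain_point_def[of f z "Suc l"])
  qed
  have c1: "c - 1 < e" "c - 1 < c" "c \<le> e" using Suc.prems(3) by auto
  obtain u' v' g where u': "u \<le> u'" "u' < v'" "v' \<le> v" and g: "g holomorphic_on rect u' v' c d"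
      "\<And>z. z \<in> rect u' v' e d \<Longrightarrow> g z = f (Suc l) z"
    using polynomial_ode_extension[OF uv(2) c1(1) ed Ah deriv c1(2,3)] by blast
  show ?case
  proof (intro exI conjI ballI)
    show "a \<le> u'" "u' < v'" "v' \<le> b" using uv u' by auto
    fix i assume i: "i \<in> {1..Suc l}"
    have "G i holomorphic_on rect u' v' c d" if "i \<le> l"
      using i that u' by (intro holomorphic_on_subset[OF G(1)]) (auto simp: mem_rect)
    then show "(G(Suc l := g)) i holomorphic_on rect u' v' c d" using i g by (auto simp: le_Suc_eq)
    fix z assume z: "z \<in> rect u' v' e d"
    then have "z \<in> rect u v e d" using u' by (auto simp: mem_rect)
    then show "(G(Suc l := g)) i z = f i z" using G(2)[of i z] g(2)[OF z] i by (auto simp: le_Suc_eq)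
  qed
qed

section \<open>Eisenstein series\<close>

definition lattice_index :: "(int \<times> int) set" where
  "lattice_index = UNIV - {(0, 0)}"

text \<open>
  The products \<open>inv_square_ext c m * inv_square_ext c n\<close> majorize the terms of the Eisenstein series:
  all of them for \<open>c = 1\<close>, and those off the coordinate axes for \<open>c = 0\<close>.
\<close>

definition inv_square_ext :: "real \<Rightarrow> int \<Rightarrow> real" where
  "inv_square_ext c m = (if m = 0 then c else 1 / of_int m ^ 2)"

lemma inv_square_ext_nonneg: "0 \<le> c \<Longrightarrow> 0 \<le> inv_square_ext c m"
  by (simp add: inv_square_ext_def)

lemma has_sum_inv_square_ext: "(inv_square_ext c has_sum (c + pi\<^sup>2 / 3)) UNIV"
proof -
  have nat: "((\<lambda>n::nat. 1 / (real n + 1) ^ 2) has_sum (pi\<^sup>2 / 6)) UNIV"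
    using inverse_squares_sums
    by (intro norm_summable_imp_has_sum) (auto simp: sums_iff add.commute)
  have pos: "(inv_square_ext c has_sum (pi\<^sup>2 / 6)) {1..}"
  proof -
    have "bij_betw (\<lambda>n::nat. int n + 1) UNIV {1..}"
      by (rule bij_betw_byWitness[where f' = "\<lambda>m. nat (m - 1)"]) auto
    from has_sum_reindex_bij_betw[OF this, of "inv_square_ext c"] show ?thesis
      using nat by (simp add: inv_square_ext_def)
  qed
  have neg: "(inv_square_ext c has_sum (pi\<^sup>2 / 6)) {..-1}"
  proof -
    have "bij_betw uminus {1..} {..-1::int}"
      by (rule bij_betw_byWitness[where f' = uminus]) auto
    moreover have "inv_square_ext c (- m) = inv_square_ext c m" for m by (simp add: inv_square_ext_def)
    ultimately show ?thesis
      using has_sum_reindex_bij_betw[of uminus "{1..}" "{..-1}" "inv_square_ext c"] pos by simp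
  qed
  have "(inv_square_ext c has_sum c) {0}"
    by (rule has_sum_finiteI) (auto simp: inv_square_ext_def)
  then have "(inv_square_ext c has_sum (c + (pi\<^sup>2 / 6 + pi\<^sup>2 / 6))) ({0} \<union> ({1..} \<union> {..-1}))"
    by (intro has_sum_Un_disjoint pos neg) auto
  moreover have "{0} \<union> ({1..} \<union> {..-1}) = (UNIV :: int set)" by auto
  ultimately show ?thesis by simp
qed

lemma has_sum_inv_square_ext_product:
  assumes "0 \<le> c"
  shows "((\<lambda>(m, n). inv_square_ext c m * inv_square_ext c n) has_sum (c + pi\<^sup>2 / 3)\<^sup>2) UNIV"
proof -
  let ?f = "\<lambda>(m, n). inv_square_ext c m * inv_square_ext c n"
  let ?S = "c + pi\<^sup>2 / 3"
  have 1: "((\<lambda>n. ?f (m, n)) has_sum (inv_square_ext c m * ?S)) UNIV" for m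
    using has_sum_cmult_right[OF has_sum_inv_square_ext] by simp
  have 2: "((\<lambda>m. inv_square_ext c m * ?S) has_sum (?S * ?S)) UNIV"
    by (rule has_sum_cmult_left[OF has_sum_inv_square_ext])
  have "?f summable_on Sigma UNIV (\<lambda>_. UNIV)"
    by (rule summable_on_SigmaI[where g = "\<lambda>m. inv_square_ext c m * ?S"])
       (use 1 2 inv_square_ext_nonneg assms in \<open>auto simp: summable_on_def\<close>)
  from has_sum_SigmaI[OF 1 2 this] show ?thesis by (simp add: power2_eq_square)
qed

text \<open>The imaginary part of the lattice point controls \<open>n\<close>, and then its real
  part controls \<open>m\<close>. The constant depends on \<tau> only through
  \<open>\<delta>\<close> and \<open>B\<close>, so it is uniform on discs.\<close>

lemma lattice_norm_bound:
  fixes m n :: int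
  assumes \<delta>: "0 < \<delta>" "\<delta> \<le> Im \<tau>" and B: "norm \<tau> \<le> B"
  shows "real_of_int (m\<^sup>2 + n\<^sup>2) \<le> (2 + (2 * B\<^sup>2 + 1) / \<delta>\<^sup>2) * (norm (of_int m + of_int n * \<tau>))\<^sup>2"
proof -
  define w where "w = of_int m + of_int n * \<tau>"
  define x y where "x = real_of_int m" and "y = real_of_int n"
  have Re: "Re w = x + y * Re \<tau>" and Im: "Im w = y * Im \<tau>" by (simp_all add: w_def x_def y_def)
  have w2: "(norm w)\<^sup>2 = (Re w)\<^sup>2 + (Im w)\<^sup>2" by (rule cmod_power2)
  have "\<delta>\<^sup>2 \<le> (Im \<tau>)\<^sup>2" using \<delta> by (intro power_mono) auto
  then have "y\<^sup>2 * \<delta>\<^sup>2 \<le> y\<^sup>2 * (Im \<tau>)\<^sup>2" by (intro mult_left_mono) auto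
  also have "\<dots> \<le> (norm w)\<^sup>2" unfolding w2 Im by (simp add: power_mult_distrib)
  finally have y: "y\<^sup>2 \<le> (norm w)\<^sup>2 / \<delta>\<^sup>2" using \<delta> by (simp add: field_simps)
  have "(Re \<tau>)\<^sup>2 \<le> B\<^sup>2"
    using abs_Re_le_cmod[of \<tau>] B by (metis abs_ge_zero order_trans power2_abs power_mono)
  then have "y\<^sup>2 * (Re \<tau>)\<^sup>2 \<le> y\<^sup>2 * B\<^sup>2" by (intro mult_left_mono) auto
  moreover have "x\<^sup>2 \<le> 2 * (Re w)\<^sup>2 + 2 * (y * Re \<tau>)\<^sup>2"
  proof -
    have "x\<^sup>2 = (Re w - y * Re \<tau>)\<^sup>2" using Re by simp
    moreover have "0 \<le> (Re w + y * Re \<tau>)\<^sup>2" by simp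
    moreover have "(Re w - y * Re \<tau>)\<^sup>2 + (Re w + y * Re \<tau>)\<^sup>2 = 2 * (Re w)\<^sup>2 + 2 * (y * Re \<tau>)\<^sup>2"
      by (simp add: power2_eq_square algebra_simps)
    ultimately show ?thesis by linarith
  qed
  moreover have "(Re w)\<^sup>2 \<le> (norm w)\<^sup>2" using w2 by simp
  ultimately have "x\<^sup>2 + y\<^sup>2 \<le> 2 * (norm w)\<^sup>2 + (2 * B\<^sup>2 + 1) * y\<^sup>2"
    by (simp add: power_mult_distrib algebra_simps)
  also have "\<dots> \<le> 2 * (norm w)\<^sup>2 + (2 * B\<^sup>2 + 1) * ((norm w)\<^sup>2 / \<delta>\<^sup>2)"
    using y by (intro add_left_mono mult_left_mono) auto
  also have "\<dots> = (2 + (2 * B\<^sup>2 + 1) / \<delta>\<^sup>2) * (norm w)\<^sup>2" by (simp add: algebra_simps)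
  finally show ?thesis by (simp add: w_def x_def y_def)
qed

lemma lattice_point_nonzero:
  assumes "0 < Im \<tau>" "(m, n) \<in> lattice_index"
  shows "of_int m + of_int n * \<tau> \<noteq> 0"
proof
  assume "of_int m + of_int n * \<tau> = 0"
  then have "real_of_int n * Im \<tau> = 0" "real_of_int m + real_of_int n * Re \<tau> = 0"
    by (simp_all add: complex_eq_iff)
  then show False using assms by (auto simp: lattice_index_def)
qed

text \<open>With \<open>S = m\<^sup>2 + n\<^sup>2 \<ge> 1\<close>, one factor \<open>1 / S\<close>
  is spent on each of \<open>m\<close> and \<open>n\<close>, and further factors only help. The
  value 1 of \<open>inv_square_ext 1\<close> at 0 covers the axes.\<close>

lemma eisenstein_term_bound:
  assumes \<delta>: "0 < \<delta>" "\<delta> \<le> Im \<tau>" and B: "norm \<tau> \<le> B" and mn: "(m, n) \<in> lattice_index" and j: "2 \<le> j"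
  shows "norm (1 / (of_int m + of_int n * \<tau>) ^ (2 * j))
      \<le> (2 + (2 * B\<^sup>2 + 1) / \<delta>\<^sup>2) ^ j * (inv_square_ext 1 m * inv_square_ext 1 n)"
proof -
  define C where "C = 2 + (2 * B\<^sup>2 + 1) / \<delta>\<^sup>2"
  define w where "w = of_int m + of_int n * \<tau>"
  define S where "S = real_of_int (m\<^sup>2 + n\<^sup>2)"
  have w: "norm w > 0" using lattice_point_nonzero[OF _ mn, of \<tau>] \<delta> by (simp add: w_def)
  have C: "C > 0" by (simp add: C_def add_pos_nonneg)
  have bd: "S \<le> C * (norm w)\<^sup>2"
    using lattice_norm_bound[OF \<delta> B, of m n] by (simp add: S_def C_def w_def)
  have ge: "1 \<le> S" "real_of_int (m\<^sup>2) \<le> S" "real_of_int (n\<^sup>2) \<le> S"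
  proof -
    have "0 < m\<^sup>2 + n\<^sup>2" using mn by (auto simp: lattice_index_def sum_power2_gt_zero_iff)
    then show "1 \<le> S" unfolding S_def by linarith
  qed (simp_all add: S_def)
  have "1 / S \<le> inv_square_ext 1 m" "1 / S \<le> inv_square_ext 1 n"
    using ge by (auto simp: inv_square_ext_def intro!: divide_left_mono)
  then have S2: "1 / S * (1 / S) \<le> inv_square_ext 1 m * inv_square_ext 1 n"
    using ge by (intro mult_mono inv_square_ext_nonneg) auto
  have "S ^ 2 \<le> S ^ j" using ge j by (intro power_increasing) auto
  then have "1 / S ^ j \<le> 1 / S ^ 2" using ge by (intro divide_left_mono) auto
  also have "\<dots> \<le> inv_square_ext 1 m * inv_square_ext 1 n" using S2 by (simp add: power2_eq_square)
  finally have Sj: "1 / S ^ j \<le> inv_square_ext 1 m * inv_square_ext 1 n" .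
  have "1 / ((norm w)\<^sup>2) \<le> C / S" using bd ge w C by (simp add: field_simps)
  then have "(1 / ((norm w)\<^sup>2)) ^ j \<le> (C / S) ^ j" by (intro power_mono) auto
  also have "\<dots> = C ^ j * (1 / S ^ j)" by (simp add: power_divide)
  also have "\<dots> \<le> C ^ j * (inv_square_ext 1 m * inv_square_ext 1 n)"
    using Sj C by (intro mult_left_mono) auto
  finally show ?thesis
    by (simp add: w_def C_def norm_divide norm_power power_divide power_mult)
qed

lemma summable_on_inv_square_bound:
  "(\<lambda>(m, n). C * (inv_square_ext 1 m * inv_square_ext 1 n)) summable_on lattice_index"
proof -
  have "(\<lambda>(m, n). inv_square_ext 1 m * inv_square_ext 1 n) summable_on UNIV"
    using has_sum_inv_square_ext_product[of 1] by (auto simp: summable_on_def)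
  then have "(\<lambda>x. C * (case x of (m, n) \<Rightarrow> inv_square_ext 1 m * inv_square_ext 1 n)) summable_on lattice_index"
    by (intro summable_on_cmult_right) (rule summable_on_subset, auto)
  then show ?thesis by (simp add: case_prod_unfold)
qed

lemma eisenstein_summable:
  assumes "0 < Im \<tau>" "2 \<le> j"
  shows "(\<lambda>(m, n). 1 / (of_int m + of_int n * \<tau>) ^ (2 * j)) summable_on lattice_index"
proof -
  have "(\<lambda>x. norm ((\<lambda>(m, n). 1 / (of_int m + of_int n * \<tau>) ^ (2 * j)) x)) summable_on lattice_index"
    by (rule Infinite_Sum.abs_summable_on_comparison_test'[OF summable_on_inv_square_bound])
       (use eisenstein_term_bound[OF assms(1) order_refl order_refl _ assms(2)] in \<open>force split: prod.splits\<close>)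
  then show ?thesis by (rule abs_summable_summable)
qed

lemma eisenstein_has_sum:
  assumes "0 < Im \<tau>" "2 \<le> j"
  shows "((\<lambda>(m, n). 1 / (of_int m + of_int n * \<tau>) ^ (2 * j)) has_sum eisenstein (2 * j) \<tau>) lattice_index"
  using has_sum_infsum[OF eisenstein_summable[OF assms]] by (simp add: eisenstein_def lattice_index_def)

lemma open_upper_half_plane: "open upper_half_plane"
  unfolding upper_half_plane_def by (rule open_halfspace_Im_gt)

lemma connected_upper_half_plane: "connected upper_half_plane"
  unfolding upper_half_plane_def by (intro convex_connected convex_halfspace_Im_gt)

lemma eisenstein_holomorphic:
  assumes j: "2 \<le> j"
  shows "eisenstein (2 * j) holomorphic_on upper_half_plane"
proof -
  have "eisenstein (2 * j) field_differentiable at z" if z: "0 < Im z" for z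
  proof -
    define \<delta> where "\<delta> = Im z / 2"
    have \<delta>: "0 < \<delta>" using z by (simp add: \<delta>_def)
    have Im: "\<delta> \<le> Im w" if "w \<in> cball z \<delta>" for w
    proof -
      have "\<bar>Im (z - w)\<bar> \<le> \<delta>" using abs_Im_le_cmod[of "z - w"] that by (simp add: dist_norm)
      then have "Im z - Im w \<le> \<delta>" by simp
      then show ?thesis by (simp add: \<delta>_def)
    qed
    have B: "norm w \<le> norm z + \<delta>" if "w \<in> cball z \<delta>" for w
    proof -
      have "norm w \<le> norm z + norm (z - w)" by norm
      then show ?thesis using that by (simp add: dist_norm)
    qed
    let ?t = "\<lambda>x (\<tau> :: complex). case x of (m, n) \<Rightarrow> 1 / (of_int m + of_int n * \<tau>) ^ (2 * j)"
    have lim: "uniform_limit (cball z \<delta>) (\<lambda>X \<tau>. \<Sum>x\<in>X. ?t x \<tau>) (eisenstein (2 * j)) (finite_subsets_at_top lattice_index)"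
    proof (rule Weierstrass_m_test_general'[OF _ _ summable_on_inv_square_bound])
      fix x \<tau> assume "x \<in> lattice_index" "\<tau> \<in> cball z \<delta>"
      then show "norm (?t x \<tau>) \<le> (\<lambda>(m, n). (2 + (2 * (norm z + \<delta>)\<^sup>2 + 1) / \<delta>\<^sup>2) ^ j *
          (inv_square_ext 1 m * inv_square_ext 1 n)) x"
        using eisenstein_term_bound[OF \<delta> Im B _ j, of \<tau>] by (cases x) auto
    next
      fix \<tau> assume "\<tau> \<in> cball z \<delta>"
      then have "0 < Im \<tau>" using Im \<delta> by force
      from eisenstein_has_sum[OF this j]
      show "((\<lambda>x. ?t x \<tau>) has_sum eisenstein (2 * j) \<tau>) lattice_index" .
    qed
    have term_hol: "?t x holomorphic_on upper_half_plane" if "x \<in> lattice_index" for x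
      using lattice_point_nonzero that
      by (cases x) (auto simp: upper_half_plane_def intro!: holomorphic_intros)
    have sub: "cball z \<delta> \<subseteq> upper_half_plane" using Im \<delta> by (force simp: upper_half_plane_def)
    have "(\<lambda>\<tau>. \<Sum>x\<in>X. ?t x \<tau>) holomorphic_on upper_half_plane" if "X \<subseteq> lattice_index" for X
      using term_hol that by (intro holomorphic_on_sum) auto
    then have "\<forall>\<^sub>F X in finite_subsets_at_top lattice_index.
        continuous_on (cball z \<delta>) (\<lambda>\<tau>. \<Sum>x\<in>X. ?t x \<tau>) \<and> (\<lambda>\<tau>. \<Sum>x\<in>X. ?t x \<tau>) holomorphic_on ball z \<delta>"
      using sub ball_subset_cball[of z \<delta>]
      by (intro eventually_finite_subsets_at_top_weakI)
         (meson holomorphic_on_imp_continuous_on holomorphic_on_subset order_trans)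
    then have "eisenstein (2 * j) holomorphic_on ball z \<delta>"
      using holomorphic_uniform_limit[OF _ lim] by (metis finite_subsets_at_top_neq_bot)
    then show ?thesis using \<delta> by (meson centre_in_ball holomorphic_on_imp_differentiable_at open_ball)
  qed
  then show ?thesis
    unfolding holomorphic_on_def upper_half_plane_def by (simp add: field_differentiable_at_within)
qed

text \<open>The matrix changes the lattice basis: m + n \<gamma>(\<tau>) is 1 / J times the lattice
  point with indices \<open>(m * d + n * b, m * c + n * a)\<close>, and determinant 1 makes this a
  bijection of the index set.\<close>

lemma eisenstein_modular:
  fixes a b c d :: int
  assumes det: "a * d - b * c = 1" and \<tau>: "0 < Im \<tau>"
  shows "eisenstein k ((of_int a * \<tau> + of_int b) / (of_int c * \<tau> + of_int d)) =
         (of_int c * \<tau> + of_int d) ^ k * eisenstein k \<tau>"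
proof -
  define J where "J = of_int c * \<tau> + of_int d"
  have "(d, c) \<in> lattice_index" using det by (auto simp: lattice_index_def)
  from lattice_point_nonzero[OF \<tau> this] have J: "J \<noteq> 0" by (simp add: J_def add.commute)
  have "eisenstein k ((of_int a * \<tau> + of_int b) / J) =
      (\<Sum>\<^sub>\<infinity>(m, n)\<in>UNIV - {(0, 0)}. J ^ k * (1 / (of_int m + of_int n * \<tau>) ^ k))"
    unfolding eisenstein_def
  proof (rule infsum_reindex_bij_witness[where i = "\<lambda>(m, n). (a * m - b * n, d * n - c * m)"
        and j = "\<lambda>(m, n). (m * d + n * b, m * c + n * a)"])
    fix x :: "int \<times> int" assume x: "x \<in> UNIV - {(0, 0)}"
    obtain m n where mn: "x = (m, n)" by (cases x)
    show *: "(\<lambda>(m, n). (a * m - b * n, d * n - c * m)) ((\<lambda>(m, n). (m * d + n * b, m * c + n * a)) x) = x"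
      using det by (simp add: mn) algebra
    then show "(\<lambda>(m, n). (m * d + n * b, m * c + n * a)) x \<in> UNIV - {(0, 0)}" using x by auto
    have "of_int m + of_int n * ((of_int a * \<tau> + of_int b) / J) =
        (of_int (m * d + n * b) + of_int (m * c + n * a) * \<tau>) / J"
      using J by (simp add: field_simps J_def)
    then show "(case (\<lambda>(m, n). (m * d + n * b, m * c + n * a)) x of
        (m, n) \<Rightarrow> J ^ k * (1 / (of_int m + of_int n * \<tau>) ^ k)) =
      (case x of (m, n) \<Rightarrow> 1 / (of_int m + of_int n * ((of_int a * \<tau> + of_int b) / J)) ^ k)"
      using J by (simp add: mn power_divide)
  next
    fix x :: "int \<times> int" assume x: "x \<in> UNIV - {(0, 0)}"
    obtain m n where mn: "x = (m, n)" by (cases x)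
    show *: "(\<lambda>(m, n). (m * d + n * b, m * c + n * a)) ((\<lambda>(m, n). (a * m - b * n, d * n - c * m)) x) = x"
      using det by (simp add: mn) algebra
    then show "(\<lambda>(m, n). (a * m - b * n, d * n - c * m)) x \<in> UNIV - {(0, 0)}" using x by auto
  qed
  also have "\<dots> = (\<Sum>\<^sub>\<infinity>x\<in>UNIV - {(0, 0)}. J ^ k * (case x of (m, n) \<Rightarrow> 1 / (of_int m + of_int n * \<tau>) ^ k))"
    by (simp add: case_prod_unfold)
  also have "\<dots> = J ^ k * eisenstein k \<tau>"
    unfolding eisenstein_def by (rule infsum_cmult_right')
  finally show ?thesis by (simp add: J_def)
qed

section \<open>Special values at \<i> and 2\<i>\<close>

lemma eisenstein_6_i: "eisenstein 6 \<i> = 0"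
proof -
  \<comment> \<open>The map z -> -1/z fixes \<i>, and the weight factor there is -1.\<close>
  have "eisenstein 6 ((of_int 0 * \<i> + of_int (-1)) / (of_int 1 * \<i> + of_int 0)) =
      (of_int 1 * \<i> + of_int 0) ^ 6 * eisenstein 6 \<i>"
    by (rule eisenstein_modular) auto
  moreover have "\<i> ^ 6 = -1" by (simp add: eval_nat_numeral)
  ultimately show ?thesis by simp
qed

text \<open>A device for showing nonvanishing at explicit points: each index pair in
  \<open>X\<close> contributes 1 up to its share of the error, and the product majorant has a known
  sum that bounds the total error.\<close>

lemma eisenstein_Re_lower_bound:
  assumes \<tau>: "0 < Im \<tau>" and j: "2 \<le> j" and c: "0 \<le> c" and X: "finite X"
    and bd: "\<And>m n. (m, n) \<in> lattice_index \<Longrightarrow>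
      (if (m, n) \<in> X then 1 else 0) - K * (inv_square_ext c m * inv_square_ext c n)
        \<le> Re (1 / (of_int m + of_int n * \<tau>) ^ (2 * j))"
    and bd0: "(0, 0) \<notin> X" "0 \<le> K"
  shows "card X - K * (c + pi\<^sup>2 / 3)\<^sup>2 \<le> Re (eisenstein (2 * j) \<tau>)"
proof (rule has_sum_mono_neutral)
  have 1: "((\<lambda>x. if x \<in> X then 1 else 0 :: real) has_sum card X) UNIV"
  proof -
    have "((\<lambda>x. 1 :: real) has_sum card X) X" using X by (intro has_sum_finiteI) auto
    moreover have "((\<lambda>x. 1 :: real) has_sum card X) X \<longleftrightarrow>
        ((\<lambda>x. if x \<in> X then 1 else 0 :: real) has_sum card X) UNIV"
      by (rule has_sum_cong_neutral) auto
    ultimately show ?thesis by blast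
  qed
  have 2: "((\<lambda>x. K * (case x of (m, n) \<Rightarrow> inv_square_ext c m * inv_square_ext c n)) has_sum K * (c + pi\<^sup>2 / 3)\<^sup>2) UNIV"
    by (rule has_sum_cmult_right[OF has_sum_inv_square_ext_product[OF c]])
  show "((\<lambda>x. (if x \<in> X then 1 else 0) - K * (case x of (m, n) \<Rightarrow> inv_square_ext c m * inv_square_ext c n))
      has_sum card X - K * (c + pi\<^sup>2 / 3)\<^sup>2) UNIV"
    using has_sum_add[OF 1 has_sum_uminusI[OF 2]] by simp
  show "((\<lambda>x. Re (case x of (m, n) \<Rightarrow> 1 / (of_int m + of_int n * \<tau>) ^ (2 * j))) has_sum
      Re (eisenstein (2 * j) \<tau>)) lattice_index"
    by (rule has_sum_Re[OF eisenstein_has_sum[OF \<tau> j]])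
  show "(if x \<in> X then 1 else 0) - K * (case x of (m, n) \<Rightarrow> inv_square_ext c m * inv_square_ext c n)
      \<le> Re (case x of (m, n) \<Rightarrow> 1 / (of_int m + of_int n * \<tau>) ^ (2 * j))" if "x \<in> UNIV \<inter> lattice_index" for x
    using bd[of "fst x" "snd x"] that by (cases x) simp
  \<comment> \<open>The comparison sum runs over all pairs, so its term at (0, 0) must not be
    positive.\<close>
  show "(if x \<in> X then 1 else 0) - K * (case x of (m, n) \<Rightarrow> inv_square_ext c m * inv_square_ext c n) \<le> 0"
    if "x \<in> UNIV - lattice_index" for x
    using that bd0 c by (auto simp: lattice_index_def inv_square_ext_def)
qed auto

lemma pi_squared_div_3_less: "pi\<^sup>2 / 3 < 4"
proof -
  have "pi < 3.2" using pi_approx by simp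
  then have "pi * pi < 3.2 * 3.2" using pi_gt_zero by (intro mult_strict_mono) auto
  then show ?thesis by (simp add: power2_eq_square)
qed

lemma neg_inverse_norm_le_Re: "- (1 / norm w) \<le> Re (1 / w)"
  using abs_Re_le_cmod[of "1 / w"] by (simp add: norm_divide abs_le_iff)

text \<open>Terms on the axes are positive, and the four units contribute 1 each. Off the axes, (x^2
  + y^2)^2 \<ge> 4 x^2 y^2 gives the factor 1/4, so the error stays below 16/4 = 4.\<close>

lemma eisenstein_4_i: "eisenstein 4 \<i> \<noteq> 0"
proof -
  define X :: "(int \<times> int) set" where "X = {(1, 0), (-1, 0), (0, 1), (0, -1)}"
  have i4: "\<i> ^ 4 = 1" by (simp add: eval_nat_numeral)
  have "card X - (1 / 4) * (0 + pi\<^sup>2 / 3)\<^sup>2 \<le> Re (eisenstein (2 * 2) \<i>)"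
  proof (rule eisenstein_Re_lower_bound)
    fix m n :: int assume mn: "(m, n) \<in> lattice_index"
    define w where "w = of_int m + of_int n * \<i>"
    show "(if (m, n) \<in> X then 1 else 0) - 1 / 4 * (inv_square_ext 0 m * inv_square_ext 0 n)
        \<le> Re (1 / (of_int m + of_int n * \<i>) ^ (2 * 2))"
    proof (cases "m = 0 \<or> n = 0")
      case True
      then have "w ^ (2 * 2) = complex_of_real (real_of_int m ^ 4 + real_of_int n ^ 4)"
        using i4 by (auto simp: w_def power_mult_distrib)
      then have "Re (1 / w ^ (2 * 2)) = 1 / (real_of_int m ^ 4 + real_of_int n ^ 4)"
        by (metis Re_complex_of_real of_real_1 of_real_divide)
      moreover have "inv_square_ext 0 m * inv_square_ext 0 n = 0" using True by (auto simp: inv_square_ext_def)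
      ultimately show ?thesis using True by (auto simp: X_def w_def)
    next
      case False
      define x y where "x = real_of_int m" and "y = real_of_int n"
      have xy: "x \<noteq> 0" "y \<noteq> 0" using False by (auto simp: x_def y_def)
      have nX: "(m, n) \<notin> X" using False by (auto simp: X_def)
      have "norm (w ^ (2 * 2)) = (x\<^sup>2 + y\<^sup>2)\<^sup>2"
        by (simp only: norm_power power_mult cmod_power2) (simp add: w_def x_def y_def)
      also have "\<dots> \<ge> 4 * (x\<^sup>2 * y\<^sup>2)"
      proof -
        have "(x\<^sup>2 + y\<^sup>2)\<^sup>2 = (x\<^sup>2 - y\<^sup>2)\<^sup>2 + 4 * (x\<^sup>2 * y\<^sup>2)" by (simp add: power2_eq_square algebra_simps)
        then show ?thesis by simp
      qed
      finally have "4 * (x\<^sup>2 * y\<^sup>2) \<le> norm (w ^ (2 * 2))" .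
      moreover have "0 < 4 * (x\<^sup>2 * y\<^sup>2)" using xy by simp
      ultimately have "1 / norm (w ^ (2 * 2)) \<le> 1 / (4 * (x\<^sup>2 * y\<^sup>2))"
        by (intro frac_le) auto
      then have "- (1 / (4 * (x\<^sup>2 * y\<^sup>2))) \<le> Re (1 / w ^ (2 * 2))"
        using neg_inverse_norm_le_Re[of "w ^ (2 * 2)"] by linarith
      then show ?thesis using nX False by (simp add: inv_square_ext_def x_def y_def w_def)
    qed
  qed (auto simp: X_def)
  moreover have "card X = 4" by (simp add: X_def)
  moreover have "(0 + pi\<^sup>2 / 3)\<^sup>2 < 4\<^sup>2"
    using pi_squared_div_3_less by (intro power_strict_mono) auto
  ultimately have "0 < Re (eisenstein (2 * 2) \<i>)"
    by simp
  then show ?thesis by auto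
qed

text \<open>Shows that g3, which vanishes at \<i>, is not the zero function. The row
  \<open>n = 0\<close> is positive and contains 2 from m = 1 and m = -1. In the other rows (x^2 + 4
  y^2)^3 \<ge> 16 x^2 y^2 * 4, with x^2 read as 1 when x = 0; this gives the factor 1/64 and an
  error below 25/64.\<close>

lemma eisenstein_6_2i: "eisenstein 6 (2 * \<i>) \<noteq> 0"
proof -
  define X :: "(int \<times> int) set" where "X = {(1, 0), (-1, 0)}"
  have "card X - (1 / 64) * (1 + pi\<^sup>2 / 3)\<^sup>2 \<le> Re (eisenstein (2 * 3) (2 * \<i>))"
  proof (rule eisenstein_Re_lower_bound)
    fix m n :: int assume mn: "(m, n) \<in> lattice_index"
    define w where "w = of_int m + of_int n * (2 * \<i>)"
    show "(if (m, n) \<in> X then 1 else 0) - 1 / 64 * (inv_square_ext 1 m * inv_square_ext 1 n)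
        \<le> Re (1 / (of_int m + of_int n * (2 * \<i>)) ^ (2 * 3))"
    proof (cases "n = 0")
      case True
      then have "w ^ (2 * 3) = complex_of_real (real_of_int m ^ 6)"
        by (simp add: w_def)
      then have "Re (1 / w ^ (2 * 3)) = 1 / real_of_int m ^ 6"
        by (metis Re_complex_of_real of_real_1 of_real_divide)
      moreover have "0 \<le> inv_square_ext 1 m * inv_square_ext 1 n" by (simp add: inv_square_ext_nonneg)
      moreover have "(if (m, n) \<in> X then 1 else 0) \<le> 1 / real_of_int m ^ 6" by (auto simp: X_def)
      ultimately show ?thesis unfolding w_def by linarith
    next
      case False
      define x y where "x = real_of_int m" and "y = real_of_int n"
      have y: "1 \<le> y\<^sup>2"
      proof -
        have "1 \<le> \<bar>n\<bar>" using False by simp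
        then have "1 \<le> \<bar>y\<bar>" unfolding y_def by linarith
        then show ?thesis by (metis one_le_power power2_abs)
      qed
      define I where "I = (if m = 0 then 1 else x\<^sup>2)"
      have I: "0 < I" "inv_square_ext 1 m = 1 / I" by (auto simp: I_def x_def inv_square_ext_def)
      have nX: "(m, n) \<notin> X" using False by (auto simp: X_def)
      have "norm (w ^ (2 * 3)) = (x\<^sup>2 + 4 * y\<^sup>2) ^ 3"
        by (simp only: norm_power power_mult cmod_power2) (simp add: w_def x_def y_def power_mult_distrib mult.commute)
      also have "\<dots> = (x\<^sup>2 + 4 * y\<^sup>2)\<^sup>2 * (x\<^sup>2 + 4 * y\<^sup>2)" by (simp add: eval_nat_numeral)
      also have "\<dots> \<ge> (16 * (I * y\<^sup>2)) * 4"
      proof (intro mult_mono)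
        show "16 * (I * y\<^sup>2) \<le> (x\<^sup>2 + 4 * y\<^sup>2)\<^sup>2"
        proof (cases "m = 0")
          case True
          have "y\<^sup>2 * 1 \<le> y\<^sup>2 * y\<^sup>2" using y by (intro mult_left_mono) auto
          then show ?thesis using True by (simp add: I_def x_def power2_eq_square)
        next
          case False
          have "(x\<^sup>2 + 4 * y\<^sup>2)\<^sup>2 = (x\<^sup>2 - 4 * y\<^sup>2)\<^sup>2 + 16 * (x\<^sup>2 * y\<^sup>2)" by (simp add: power2_eq_square algebra_simps)
          then show ?thesis using False by (simp add: I_def)
        qed
        have "0 \<le> x\<^sup>2" by simp
        then show "4 \<le> x\<^sup>2 + 4 * y\<^sup>2" using y by linarith
      qed auto
      finally have "64 * (I * y\<^sup>2) \<le> norm (w ^ (2 * 3))" by simp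
      moreover have "0 < 64 * (I * y\<^sup>2)" using I(1) y by (intro mult_pos_pos) auto
      ultimately have "1 / norm (w ^ (2 * 3)) \<le> 1 / (64 * (I * y\<^sup>2))"
        by (intro frac_le) auto
      then have "- (1 / (64 * (I * y\<^sup>2))) \<le> Re (1 / w ^ (2 * 3))"
        using neg_inverse_norm_le_Re[of "w ^ (2 * 3)"] by linarith
      moreover have "inv_square_ext 1 n = 1 / y\<^sup>2" using False by (simp add: y_def inv_square_ext_def)
      ultimately show ?thesis using nX I by (simp add: w_def)
    qed
  qed (auto simp: X_def)
  moreover have "card X = 2" by (simp add: X_def)
  moreover have "(1 + pi\<^sup>2 / 3)\<^sup>2 < 5\<^sup>2"
    using pi_squared_div_3_less by (intro power_strict_mono) auto
  ultimately have "0 < Re (eisenstein (2 * 3) (2 * \<i>))"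
    by simp
  then show ?thesis by auto
qed

section \<open>The modular function near the real line\<close>

text \<open>Numerator and denominator of \<open>klein_j\<close> are kept apart as holomorphic forms
  of weight 12 = 3 * 4 = 2 * 6. A relation homogeneous of degree n in the two is holomorphic on the
  whole upper half plane in \<tau> and transforms by the single factor
  \<open>J ^ (12 * n)\<close>.\<close>

definition j_num :: "complex \<Rightarrow> complex" where
  "j_num \<tau> = 1728 * weierstrass_g2 \<tau> ^ 3"

definition modular_disc :: "complex \<Rightarrow> complex" where
  "modular_disc \<tau> = weierstrass_g2 \<tau> ^ 3 - 27 * weierstrass_g3 \<tau> ^ 2"

lemma klein_j_eq: "klein_j \<tau> = j_num \<tau> / modular_disc \<tau>"
  by (simp add: klein_j_def j_num_def modular_disc_def)

lemma g2_g3_holomorphic: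
  "weierstrass_g2 holomorphic_on upper_half_plane" "weierstrass_g3 holomorphic_on upper_half_plane"
proof -
  have "eisenstein 4 holomorphic_on upper_half_plane" "eisenstein 6 holomorphic_on upper_half_plane"
    using eisenstein_holomorphic[of 2] eisenstein_holomorphic[of 3] by simp_all
  then show "weierstrass_g2 holomorphic_on upper_half_plane" "weierstrass_g3 holomorphic_on upper_half_plane"
    unfolding weierstrass_g2_def[abs_def] weierstrass_g3_def[abs_def] by (auto intro!: holomorphic_intros)
qed

lemma j_num_holomorphic: "j_num holomorphic_on upper_half_plane"
  unfolding j_num_def[abs_def] using g2_g3_holomorphic by (intro holomorphic_intros)

lemma modular_disc_holomorphic: "modular_disc holomorphic_on upper_half_plane"
  unfolding modular_disc_def[abs_def] using g2_g3_holomorphic by (intro holomorphic_intros)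

lemma weight_12:
  fixes a b c d :: int
  assumes "a * d - b * c = 1" "0 < Im \<tau>"
  shows "j_num ((of_int a * \<tau> + of_int b) / (of_int c * \<tau> + of_int d)) =
           (of_int c * \<tau> + of_int d) ^ 12 * j_num \<tau>"
    and "modular_disc ((of_int a * \<tau> + of_int b) / (of_int c * \<tau> + of_int d)) =
           (of_int c * \<tau> + of_int d) ^ 12 * modular_disc \<tau>"
  using eisenstein_modular[OF assms, of 4] eisenstein_modular[OF assms, of 6]
  by (simp_all add: j_num_def modular_disc_def weierstrass_g2_def weierstrass_g3_def
      power_mult_distrib right_diff_distrib flip: power_mult)

lemma modular_disc_i: "modular_disc \<i> \<noteq> 0" "j_num \<i> = 1728 * modular_disc \<i>"
  using eisenstein_4_i eisenstein_6_i
  by (auto simp: modular_disc_def j_num_def weierstrass_g2_def weierstrass_g3_def)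

lemma eventually_modular_disc_nonzero:
  assumes z: "0 < Im z"
  shows "\<forall>\<^sub>F w in at z. modular_disc w \<noteq> 0"
proof -
  have "{w \<in> upper_half_plane. modular_disc w = 0} sparse_in upper_half_plane"
    by (rule holomorphic_zeros_sparse[OF modular_disc_holomorphic open_upper_half_plane
          connected_upper_half_plane _ modular_disc_i(1)]) (simp add: upper_half_plane_def)
  then have "\<forall>\<^sub>F w in at z. w \<notin> {w \<in> upper_half_plane. modular_disc w = 0}"
    using z unfolding sparse_in_eventually_iff[OF open_upper_half_plane] by (simp add: upper_half_plane_def)
  moreover have "\<forall>\<^sub>F w in at z. w \<in> upper_half_plane"
    using z by (intro eventually_at_in_open' open_upper_half_plane) (simp add: upper_half_plane_def)
  ultimately show ?thesis by eventually_elim auto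
qed

text \<open>Dividing by the n-th power of the discriminant makes \<open>J\<close> a root of a
  polynomial. With finitely many roots available, the continuous \<open>J\<close> is constant near
  \<i>, with value 1728; this forces g3 = 0 there, hence everywhere, against its value at
  2\<i>.\<close>

lemma j_num_modular_disc_homogeneous_independent:
  assumes rel: "\<And>\<tau>. 0 < Im \<tau> \<Longrightarrow> (\<Sum>k\<le>n. a k * j_num \<tau> ^ k * modular_disc \<tau> ^ (n - k)) = 0"
    and k: "k \<le> n"
  shows "a k = 0"
proof (rule ccontr)
  assume ak: "a k \<noteq> 0"
  define p where "p = (\<Sum>k\<le>n. monom (a k) k)"
  have "coeff p k = a k" using k by (simp add: p_def coeff_sum if_distrib cong: if_cong)
  then have "p \<noteq> 0" using ak by auto
  then have fin: "finite {w. poly p w = 0}" by (rule poly_roots_finite)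
  define J where "J = (\<lambda>\<tau>. j_num \<tau> / modular_disc \<tau>)"
  define D where "D = {\<tau> \<in> upper_half_plane. modular_disc \<tau> \<noteq> 0}"
  have root: "poly p (J \<tau>) = 0" if "\<tau> \<in> D" for \<tau>
  proof -
    have nz: "modular_disc \<tau> \<noteq> 0" and \<tau>: "0 < Im \<tau>" using that by (auto simp: D_def upper_half_plane_def)
    have "(\<Sum>k\<le>n. a k * j_num \<tau> ^ k * modular_disc \<tau> ^ (n - k)) = (\<Sum>k\<le>n. modular_disc \<tau> ^ n * (a k * J \<tau> ^ k))"
    proof (rule sum.cong)
      fix k assume "k \<in> {..n}"
      then have "modular_disc \<tau> ^ n = modular_disc \<tau> ^ (n - k) * modular_disc \<tau> ^ k" by (simp flip: power_add)
      then show "a k * j_num \<tau> ^ k * modular_disc \<tau> ^ (n - k) = modular_disc \<tau> ^ n * (a k * J \<tau> ^ k)"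
        using nz by (simp add: J_def power_divide)
    qed simp
    then have "modular_disc \<tau> ^ n * poly p (J \<tau>) = 0"
      using rel[OF \<tau>] by (simp add: p_def poly_sum poly_monom sum_distrib_left)
    then show ?thesis using nz by simp
  qed
  have opD: "open D"
  proof -
    have "D = upper_half_plane \<inter> modular_disc -` (- {0})" by (auto simp: D_def)
    then show ?thesis
      using continuous_open_preimage[OF holomorphic_on_imp_continuous_on[OF modular_disc_holomorphic]
          open_upper_half_plane, of "- {0}"] by auto
  qed
  have iD: "\<i> \<in> D" using modular_disc_i by (simp add: D_def upper_half_plane_def)
  then obtain r where r: "r > 0" "ball \<i> r \<subseteq> D" using openE[OF opD] by blast
  have "D \<subseteq> upper_half_plane" by (auto simp: D_def)
  then have "J holomorphic_on D"
    using j_num_holomorphic modular_disc_holomorphic unfolding J_def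
    by (intro holomorphic_intros) (auto elim: holomorphic_on_subset simp: D_def)
  then have "continuous_on (ball \<i> r) J"
    using r by (meson holomorphic_on_imp_continuous_on continuous_on_subset)
  moreover have "finite (J ` ball \<i> r)"
    by (rule finite_subset[OF _ fin]) (use root r in auto)
  ultimately have "J constant_on ball \<i> r"
    by (intro continuous_finite_range_constant) auto
  then have "J \<tau> = J \<i>" if "\<tau> \<in> ball \<i> r" for \<tau>
    using that r unfolding constant_on_def by (metis centre_in_ball)
  then have g3: "weierstrass_g3 \<tau> = 0" if "\<tau> \<in> ball \<i> r" for \<tau>
  proof -
    have "J \<i> = 1728" using modular_disc_i by (simp add: J_def)
    moreover have "modular_disc \<tau> \<noteq> 0" using that r by (auto simp: D_def)
    ultimately have "j_num \<tau> = 1728 * modular_disc \<tau>"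
      using \<open>\<And>\<tau>. \<tau> \<in> ball \<i> r \<Longrightarrow> J \<tau> = J \<i>\<close>[OF that] by (simp add: J_def field_simps)
    then show ?thesis by (simp add: j_num_def modular_disc_def)
  qed
  have "weierstrass_g3 (2 * \<i>) = 0"
  proof (rule analytic_continuation_open[of "ball \<i> r" upper_half_plane weierstrass_g3 "\<lambda>_. 0"])
    show "ball \<i> r \<noteq> {}" using r by simp
    show "ball \<i> r \<subseteq> upper_half_plane" using r by (auto simp: D_def)
  qed (use g3 g2_g3_holomorphic open_upper_half_plane connected_upper_half_plane in
       \<open>auto simp: upper_half_plane_def\<close>)
  then show False using eisenstein_6_2i by (simp add: weierstrass_g3_def)
qed

lemma unimodular_with_column_ratio_between:
  fixes u v :: real
  assumes "u < v"
  obtains a b c d :: int where "a * d - b * c = 1" "c > 0" "u < a / c" "a / c < v"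
proof -
  obtain x where x: "x \<in> \<rat>" "u < x" "x < v" using Rats_dense_in_real[OF assms] by blast
  then obtain q where q: "x = of_rat q" by (auto elim: Rats_cases)
  obtain a c where ac: "quotient_of q = (a, c)" by (cases "quotient_of q")
  have c: "c > 0" "coprime a c" using quotient_of_denom_pos[OF ac] quotient_of_coprime[OF ac] by auto
  have xac: "x = a / c" using quotient_of_div[OF ac] q by (simp add: of_rat_divide)
  obtain s t where "s * a + t * c = gcd a c" using bezout_int by blast
  then have "a * s - (- t) * c = 1" using c by (simp add: algebra_simps)
  then show thesis using that c x xac by blast
qed

text \<open>The images of \<open>\<tau>\<close> under \<open>\<gamma> T\<^sup>n\<close> accumulate at the real point \<open>a / c = \<gamma>(\<infinity>)\<close>.\<close>
lemma vanishes_if_zero_on_orbit: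
  assumes hol: "\<Phi> holomorphic_on rect u v s t" and uv: "u < v" and st: "s < 0" "0 < t"
    and \<tau>: "0 < Im \<tau>"
    and zero: "\<And>a b c d :: int. \<lbrakk>a * d - b * c = 1;
        (of_int a * \<tau> + of_int b) / (of_int c * \<tau> + of_int d) \<in> rect u v s t\<rbrakk>
        \<Longrightarrow> \<Phi> ((of_int a * \<tau> + of_int b) / (of_int c * \<tau> + of_int d)) = 0"
    and z: "z \<in> rect u v s t"
  shows "\<Phi> z = 0"
proof -
  obtain a b c d :: int where det: "a * d - b * c = 1" and c: "c > 0" and ac: "u < a / c" "a / c < v"
    using unimodular_with_column_ratio_between[OF uv] .
  define \<xi> where "\<xi> = (of_int a / of_int c :: complex)"
  \<comment> \<open>The image of \<tau> + n under the matrix, written with a single unimodular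
    matrix so that \<open>zero\<close> applies.\<close>
  define g where "g = (\<lambda>n::nat. (of_int a * \<tau> + of_int (b + a * int n)) / (of_int c * \<tau> + of_int (d + c * int n)))"
  define D where "D = (\<lambda>n::nat. of_int c * \<tau> + of_int (d + c * int n))"
  have Im\<xi>: "Re \<xi> = a / c" "Im \<xi> = 0" by (simp_all add: \<xi>_def)
  have \<xi>R: "\<xi> \<in> rect u v s t" using ac st Im\<xi> by (simp add: mem_rect)
  have det': "a * (d + c * int n) - (b + a * int n) * c = 1" for n using det by (simp add: algebra_simps)
  have Dnz: "D n \<noteq> 0" for n
  proof -
    have "Im (D n) = c * Im \<tau>" by (simp add: D_def)
    then show ?thesis using c \<tau> by auto
  qed
  \<comment> \<open>Determinant 1 gives \<gamma>(w) = a/c - 1/(c (c w + d)): the limit a/c is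
    visible and never attained.\<close>
  have gn: "g n = \<xi> - 1 / (of_int c * D n)" for n
  proof -
    have "of_int a * D n - of_int c * (of_int a * \<tau> + of_int (b + a * int n)) =
        (of_int (a * (d + c * int n) - (b + a * int n) * c) :: complex)"
      by (simp add: D_def algebra_simps)
    also have "\<dots> = 1" by (simp only: det' of_int_1)
    finally have "of_int c * (of_int a * \<tau> + of_int (b + a * int n)) = of_int a * D n - 1" by (simp add: algebra_simps)
    moreover have "g n = of_int c * (of_int a * \<tau> + of_int (b + a * int n)) / (of_int c * D n)"
      using c by (simp add: g_def D_def del: of_int_add of_int_mult)
    ultimately have "g n = of_int a * D n / (of_int c * D n) - 1 / (of_int c * D n)"
      by (simp only: diff_divide_distrib)
    then show ?thesis using Dnz[of n] by (simp add: \<xi>_def)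
  qed
  have lim: "g \<longlonglongrightarrow> \<xi>"
  proof -
    have "filterlim (\<lambda>n::nat. real n) at_top sequentially" by (rule filterlim_real_sequentially)
    then have "filterlim (\<lambda>n::nat. of_int c * real n) at_top sequentially"
      using c by (intro filterlim_tendsto_pos_mult_at_top[OF tendsto_const]) auto
    then have "filterlim (\<lambda>n::nat. (of_int (c * int n) :: complex)) at_infinity sequentially"
      by (intro filterlim_norm_at_top_imp_at_infinity) (use c in \<open>simp add: norm_mult\<close>)
    then have "filterlim (\<lambda>n::nat. (of_int c * \<tau> + of_int d) + of_int (c * int n)) at_infinity sequentially"
      by (intro tendsto_add_filterlim_at_infinity[OF tendsto_const])
    then have "filterlim D at_infinity sequentially"
      by (simp add: D_def add.assoc)
    then have "(\<lambda>n. inverse (D n)) \<longlonglongrightarrow> 0"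
      by (rule filterlim_compose[OF tendsto_inverse_0])
    then have "(\<lambda>n. \<xi> - 1 / of_int c * inverse (D n)) \<longlonglongrightarrow> \<xi> - 1 / of_int c * 0"
      by (intro tendsto_intros)
    moreover have "g = (\<lambda>n. \<xi> - 1 / of_int c * inverse (D n))"
      by (simp add: fun_eq_iff gn divide_simps)
    ultimately show ?thesis by simp
  qed
  have "\<xi> islimpt {z \<in> rect u v s t. \<Phi> z = 0}"
    unfolding islimpt_sequential
  proof -
    have "\<forall>\<^sub>F n in sequentially. g n \<in> rect u v s t"
      using topological_tendstoD[OF lim open_rect \<xi>R] .
    then obtain M where M: "\<And>n. n \<ge> M \<Longrightarrow> g n \<in> rect u v s t" by (auto simp: eventually_sequentially)
    have "g n \<noteq> \<xi>" for n using gn[of n] Dnz[of n] c by simp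
    moreover have "\<Phi> (g n) = 0" if "n \<ge> M" for n
      using zero[OF det', of n] M[OF that] by (simp add: g_def)
    ultimately have "\<forall>n. g (n + M) \<in> {z \<in> rect u v s t. \<Phi> z = 0} - {\<xi>}" using M by auto
    moreover have "(\<lambda>n. g (n + M)) \<longlonglongrightarrow> \<xi>" using lim by (rule LIMSEQ_ignore_initial_segment)
    ultimately show "\<exists>f. (\<forall>n::nat. f n \<in> {z \<in> rect u v s t. \<Phi> z = 0} - {\<xi>}) \<and> f \<longlonglongrightarrow> \<xi>"
      by (intro exI[of _ "\<lambda>n. g (n + M)"]) simp
  qed
  then show ?thesis
    by (intro analytic_continuation[OF hol open_rect connected_rect _ \<xi>R _ _ z,
          where U = "{z \<in> rect u v s t. \<Phi> z = 0}"]) blast+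
qed

lemma rect_neighbourhood:
  assumes "open S" "z \<in> S"
  obtains a b s t where "z \<in> rect a b s t" "rect a b s t \<subseteq> S"
proof -
  obtain r where r: "r > 0" "ball z r \<subseteq> S" using openE[OF assms] by blast
  show thesis
  proof (rule that[of "Re z - r / 2" "Re z + r / 2" "Im z - r / 2" "Im z + r / 2"])
    show "z \<in> rect (Re z - r / 2) (Re z + r / 2) (Im z - r / 2) (Im z + r / 2)" using r by (simp add: mem_rect)
    show "rect (Re z - r / 2) (Re z + r / 2) (Im z - r / 2) (Im z + r / 2) \<subseteq> S"
    proof
      fix w assume "w \<in> rect (Re z - r / 2) (Re z + r / 2) (Im z - r / 2) (Im z + r / 2)"
      then have w: "Re z - r / 2 < Re w" "Re w < Re z + r / 2" "Im z - r / 2 < Im w" "Im w < Im z + r / 2"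
        by (auto simp: mem_rect)
      have "norm (z - w) \<le> \<bar>Re (z - w)\<bar> + \<bar>Im (z - w)\<bar>" by (rule cmod_le)
      also have "\<dots> < r" using w unfolding minus_complex.sel by linarith
      finally show "w \<in> S" using r by (auto simp: dist_norm)
    qed
  qed
qed

lemma cpoly_eval_cong:
  assumes "cpoly_vars P \<subseteq> {0..l}" "\<And>i. i \<in> {1..l} \<Longrightarrow> f i z = g i z"
  shows "cpoly_eval P (chain_point f z) = cpoly_eval P (chain_point g z)"
proof -
  have "chain_point f z v = chain_point g z v" if "m \<in> Poly_Mapping.keys P" "v \<in> Poly_Mapping.keys m" for m v
  proof -
    have "v \<le> l" using assms(1) that by (auto simp: cpoly_vars_def)
    then show ?thesis using assms(2)[of v] by (simp add: chain_point_def)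
  qed
  then show ?thesis unfolding cpoly_eval_def by (intro sum.cong prod.cong refl arg_cong2[where f = "(*)"]) auto
qed

theorem theorem3p1:
  fixes V :: "complex set"
  assumes "V \<subseteq> fundamental_domain" and "open V" and "V \<noteq> {}"
  shows "\<not> (\<exists>(l :: nat) (f :: nat \<Rightarrow> complex \<Rightarrow> complex).
             pfaffian_chain V l f \<and> algebraic_over_functions V (chain_field V l f) klein_j)"
proof (intro notI, elim exE conjE)
  fix l f assume chain: "pfaffian_chain V l f" and alg: "algebraic_over_functions V (chain_field V l f) klein_j"
  have VH: "V \<subseteq> upper_half_plane" using assms(1) by (auto simp: fundamental_domain_def)
  obtain p where vars: "\<And>i. i \<in> {1..l} \<Longrightarrow> cpoly_vars (p i) \<subseteq> {0..i}"
    and deriv: "\<And>i z. \<lbrakk>i \<in> {1..l}; z \<in> V\<rbrakk> \<Longrightarrow> (f i has_field_derivative cpoly_eval (p i) (chain_point f z)) (at z)"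
    using chain unfolding pfaffian_chain_def by blast
  have fhol: "f i holomorphic_on V" if "i \<in> {1..l}" for i
    using deriv[OF that] by (rule holomorphic_onI_deriv)
  obtain n c k0 where cK: "\<And>k. k \<le> n \<Longrightarrow> c k \<in> chain_field V l f"
    and k0: "k0 \<le> n" "\<not> (\<forall>\<^sub>\<approx>z\<in>V. c k0 z = 0)"
    and rel: "\<forall>\<^sub>\<approx>z\<in>V. (\<Sum>k\<le>n. c k z * klein_j z ^ k) = 0"
    using alg unfolding algebraic_over_functions_def by blast
  define rep where "rep = (\<lambda>k P Q.
      c k = (\<lambda>z. cpoly_eval P (chain_point f z) / cpoly_eval Q (chain_point f z)) \<and>
      cpoly_vars P \<subseteq> {0..l} \<and> cpoly_vars Q \<subseteq> {0..l} \<and> (\<forall>\<^sub>\<approx>z\<in>V. cpoly_eval Q (chain_point f z) \<noteq> 0))"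
  have "\<exists>P Q. rep k P Q" if "k \<le> n" for k
    using cK[OF that] unfolding chain_field_def rep_def by blast
  then obtain P Q where rep: "\<And>k. k \<le> n \<Longrightarrow> rep k (P k) (Q k)" by metis
  have c_eq: "c k z = cpoly_eval (P k) (chain_point f z) / cpoly_eval (Q k) (chain_point f z)"
    and Pv: "cpoly_vars (P k) \<subseteq> {0..l}" and Qv: "cpoly_vars (Q k) \<subseteq> {0..l}"
    and Q: "\<forall>\<^sub>\<approx>z\<in>V. cpoly_eval (Q k) (chain_point f z) \<noteq> 0" if "k \<le> n" for k z
    using rep[OF that] unfolding rep_def by (auto dest: fun_cong)
  txt \<open>\<open>V\<close> may be disconnected, so the box has to be placed where \<open>c k0\<close> does not vanish.\<close>
  have "\<exists>z\<in>V. c k0 z \<noteq> 0"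
  proof (rule ccontr)
    assume "\<not> ?thesis"
    then have "{z. c k0 z \<noteq> 0} sparse_in V" by (intro sparse_disjoint assms) auto
    then show False using k0 by (simp add: eventually_cosparse)
  qed
  then obtain z0 where z0: "z0 \<in> V" "cpoly_eval (P k0) (chain_point f z0) \<noteq> 0"
    using c_eq[OF k0(1)] by auto
  \<comment> \<open>The numerator of \<open>c k0\<close> stays nonzero throughout a box in
    \<open>V1\<close>; the denominators are dealt with off a sparse set.\<close>
  define V1 where "V1 = V \<inter> (\<lambda>z. cpoly_eval (P k0) (chain_point f z)) -` (- {0})"
  have "open V1"
    unfolding V1_def
    by (intro continuous_open_preimage holomorphic_on_imp_continuous_on holomorphic_on_cpoly_eval[of l])
       (use fhol Pv[OF k0(1)] assms in auto)
  moreover have "z0 \<in> V1" using z0 by (simp add: V1_def)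
  ultimately obtain a b e d where z0r: "z0 \<in> rect a b e d" and r1: "rect a b e d \<subseteq> V1"
    by (rule rect_neighbourhood)
  have rV: "rect a b e d \<subseteq> V" using r1 by (auto simp: V1_def)
  have ab: "a < b" "e < d" using z0r by (auto simp: mem_rect)
  have e0: "0 \<le> e"
  proof (rule ccontr)
    assume "\<not> 0 \<le> e"
    then have "Complex (Re z0) ((e + min 0 d) / 2) \<in> rect a b e d" using z0r by (auto simp: mem_rect min_def)
    then have "0 < Im (Complex (Re z0) ((e + min 0 d) / 2))" using rV VH by (auto simp: upper_half_plane_def)
    then show False using \<open>\<not> 0 \<le> e\<close> by (simp add: min_def split: if_splits)
  qed
  \<comment> \<open>The height -1 stands for any negative height: the extended box must contain a
    real segment in its interior.\<close>
  have "\<exists>u v G. a \<le> u \<and> u < v \<and> v \<le> b \<and>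
     (\<forall>i\<in>{1..l}. G i holomorphic_on rect u v (-1) d \<and> (\<forall>z\<in>rect u v e d. G i z = f i z))"
    by (rule pfaffian_chain_extension[OF ab vars]) (use deriv rV e0 in auto)
  then obtain u v G where uv: "a \<le> u" "u < v" "v \<le> b"
    and Gh: "\<And>i. i \<in> {1..l} \<Longrightarrow> G i holomorphic_on rect u v (-1) d"
    and Gf: "\<And>i z. \<lbrakk>i \<in> {1..l}; z \<in> rect u v e d\<rbrakk> \<Longrightarrow> G i z = f i z"
    by blast
  define R where "R = rect u v (-1) d"
  define R1 where "R1 = rect u v e d"
  have R1V: "R1 \<subseteq> V1" "R1 \<subseteq> V" using r1 rV uv by (auto simp: R1_def mem_rect subset_iff)
  have R1R: "R1 \<subseteq> R" using e0 by (auto simp: R1_def R_def mem_rect)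
  define PG where "PG = (\<lambda>k z. cpoly_eval (P k) (chain_point G z))"
  define QG where "QG = (\<lambda>k z. cpoly_eval (Q k) (chain_point G z))"
  \<comment> \<open>On the original box this is \<open>c k\<close> times the product of all
    denominators, wherever these are nonzero.\<close>
  define W where "W = (\<lambda>k z. PG k z * (\<Prod>i\<in>{..n} - {k}. QG i z))"
  have PGh: "PG k holomorphic_on R" and QGh: "QG k holomorphic_on R" if "k \<le> n" for k
    unfolding PG_def QG_def R_def using Gh Pv[OF that] Qv[OF that] by (intro holomorphic_on_cpoly_eval[of l]; auto)+
  have Wh: "W k holomorphic_on R" if "k \<le> n" for k
    unfolding W_def using PGh QGh that by (intro holomorphic_intros) auto
  have PGf: "PG k z = cpoly_eval (P k) (chain_point f z)" "QG k z = cpoly_eval (Q k) (chain_point f z)"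
    if "k \<le> n" "z \<in> R1" for k z
    unfolding PG_def QG_def
    by (rule cpoly_eval_cong[OF Pv[OF that(1)]] cpoly_eval_cong[OF Qv[OF that(1)]],
        use Gf that(2) in \<open>simp add: R1_def\<close>)+
  have evQ: "\<forall>\<^sub>F z in at z1. z \<in> R1 \<and> (\<forall>k\<le>n. QG k z \<noteq> 0)" if "z1 \<in> R1" for z1
  proof -
    have "\<forall>\<^sub>F z in at z1. \<forall>k\<in>{..n}. cpoly_eval (Q k) (chain_point f z) \<noteq> 0"
      using Q R1V(2) that by (intro eventually_ball_finite) (auto intro: eventually_cosparse_imp_eventually_at)
    moreover have "\<forall>\<^sub>F z in at z1. z \<in> R1"
      using that unfolding R1_def by (intro eventually_at_in_open') auto
    ultimately show ?thesis by eventually_elim (use PGf in auto)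
  qed
  \<comment> \<open>The cleared relation with the two roles of z separated: \<tau> enters the
    modular forms, z the coefficients. The relation itself lives on the diagonal.\<close>
  define \<Phi> where "\<Phi> = (\<lambda>\<tau> z. \<Sum>k\<le>n. W k z * j_num \<tau> ^ k * modular_disc \<tau> ^ (n - k))"
  have zero1: "\<Phi> z1 z1 = 0" if z1: "z1 \<in> R1" for z1
  proof -
    \<comment> \<open>The meromorphic relation is available only in a punctured neighbourhood of
      \<open>z1\<close>; continuity of the cleared form fills in \<open>z1\<close>.\<close>
    have "\<forall>\<^sub>F z in at z1. (\<Sum>k\<le>n. c k z * klein_j z ^ k) = 0"
      using eventually_cosparse_imp_eventually_at[OF rel] R1V(2) z1 by blast
    moreover have "\<forall>\<^sub>F z in at z1. modular_disc z \<noteq> 0"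
      using R1V(2) VH z1 by (intro eventually_modular_disc_nonzero) (auto simp: upper_half_plane_def)
    ultimately have ev: "\<forall>\<^sub>F z in at z1. \<Phi> z z = 0"
      using evQ[OF z1]
    proof eventually_elim
      case (elim z)
      define q where "q = (\<Prod>i\<le>n. QG i z)"
      have "W k z * j_num z ^ k * modular_disc z ^ (n - k) = q * modular_disc z ^ n * (c k z * klein_j z ^ k)"
        if k: "k \<le> n" for k
      proof -
        have "q = QG k z * (\<Prod>i\<in>{..n} - {k}. QG i z)" unfolding q_def using k by (intro prod.remove) auto
        moreover have "c k z = PG k z / QG k z" using c_eq[OF k] PGf[OF k] elim by auto
        moreover have "modular_disc z ^ n = modular_disc z ^ (n - k) * modular_disc z ^ k"
          using k by (simp flip: power_add)
        ultimately show ?thesis using elim k by (simp add: W_def klein_j_eq power_divide)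
      qed
      then have "\<Phi> z z = q * modular_disc z ^ n * (\<Sum>k\<le>n. c k z * klein_j z ^ k)"
        unfolding \<Phi>_def sum_distrib_left by (intro sum.cong) auto
      then show ?case using elim by simp
    qed
    have sub: "R1 \<subseteq> upper_half_plane" using R1V VH by blast
    have "(\<lambda>z. \<Phi> z z) holomorphic_on R1"
      unfolding \<Phi>_def
      by (intro holomorphic_intros holomorphic_on_subset[OF Wh] holomorphic_on_subset[OF j_num_holomorphic sub]
          holomorphic_on_subset[OF modular_disc_holomorphic sub]) (use R1R in auto)
    then have "isCont (\<lambda>z. \<Phi> z z) z1"
      using z1 unfolding R1_def by (meson continuous_on_eq_continuous_at holomorphic_on_imp_continuous_on open_rect)
    then have "((\<lambda>z. \<Phi> z z) \<longlongrightarrow> \<Phi> z1 z1) (at z1)" by (simp add: isCont_def)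
    moreover have "((\<lambda>z. \<Phi> z z) \<longlongrightarrow> 0) (at z1)" using ev by (rule tendsto_eventually)
    ultimately show ?thesis by (intro tendsto_unique[of "at z1"]) auto
  qed
  \<comment> \<open>The diagonal identity spreads from the original box to the whole part of the
    extended box above the real line, where coefficients and forms are both holomorphic.\<close>
  have zero2: "\<Phi> z z = 0" if "z \<in> rect u v 0 d" for z
  proof (rule analytic_continuation_open[of R1 "rect u v 0 d" "\<lambda>z. \<Phi> z z" "\<lambda>_. 0"])
    have sub: "rect u v 0 d \<subseteq> upper_half_plane" "rect u v 0 d \<subseteq> R"
      by (auto simp: mem_rect upper_half_plane_def R_def)
    show "(\<lambda>z. \<Phi> z z) holomorphic_on rect u v 0 d"
      unfolding \<Phi>_def
      by (intro holomorphic_intros holomorphic_on_subset[OF Wh] holomorphic_on_subset[OF j_num_holomorphic sub(1)]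
          holomorphic_on_subset[OF modular_disc_holomorphic sub(1)]) (use sub in auto)
    show "R1 \<noteq> {}" using uv ab by (simp add: R1_def rect_eq_empty_iff)
  qed (use that zero1 e0 in \<open>auto simp: R1_def mem_rect\<close>)
  have zero3: "\<Phi> \<tau> z = 0" if \<tau>: "0 < Im \<tau>" and z: "z \<in> R" for \<tau> z
  proof (rule vanishes_if_zero_on_orbit[of "\<Phi> \<tau>" u v "-1" d \<tau>])
    show "\<Phi> \<tau> holomorphic_on rect u v (- 1) d"
      unfolding \<Phi>_def using Wh by (intro holomorphic_intros) (auto simp: R_def)
    fix \<alpha> \<beta> \<gamma> \<delta> :: int
    define J where "J = of_int \<gamma> * \<tau> + of_int \<delta>"
    define w where "w = (of_int \<alpha> * \<tau> + of_int \<beta>) / J"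
    assume det: "\<alpha> * \<delta> - \<beta> * \<gamma> = 1"
      and wR: "(of_int \<alpha> * \<tau> + of_int \<beta>) / (of_int \<gamma> * \<tau> + of_int \<delta>) \<in> rect u v (- 1) d"
    have "(\<delta>, \<gamma>) \<in> lattice_index" using det by (auto simp: lattice_index_def)
    from lattice_point_nonzero[OF \<tau> this] have J: "J \<noteq> 0" by (simp add: J_def add.commute)
    \<comment> \<open>\<open>wR\<close> only says that the height exceeds -1, while
      \<open>zero2\<close> requires a point above the real line.\<close>
    have "0 < Im w"
    proof -
      have "Im w = Im \<tau> / (norm J)\<^sup>2"
      proof -
        have "Im w = (\<alpha> * Im \<tau> * (\<gamma> * Re \<tau> + \<delta>) - (\<alpha> * Re \<tau> + \<beta>) * (\<gamma> * Im \<tau>)) / (norm J)\<^sup>2"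
          unfolding w_def by (simp add: Im_divide cmod_power2) (simp add: J_def)
        also have "\<alpha> * Im \<tau> * (\<gamma> * Re \<tau> + \<delta>) - (\<alpha> * Re \<tau> + \<beta>) * (\<gamma> * Im \<tau>) = real_of_int (\<alpha> * \<delta> - \<beta> * \<gamma>) * Im \<tau>"
          by (simp add: algebra_simps)
        finally show ?thesis by (simp add: det)
      qed
      then show ?thesis using \<tau> J by simp
    qed
    then have "w \<in> rect u v 0 d" using wR by (auto simp: w_def J_def mem_rect)
    then have "\<Phi> w w = 0" by (rule zero2)
    \<comment> \<open>Every term has degree n in forms of weight 12 and picks up the same factor.
      The coefficients stay at \<open>w\<close>, so the diagonal zero becomes a zero of
      \<open>\<Phi> \<tau>\<close>.\<close>
    moreover have "\<Phi> w w = J ^ (12 * n) * \<Phi> \<tau> w"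
    proof -
      have "j_num w = J ^ 12 * j_num \<tau>" "modular_disc w = J ^ 12 * modular_disc \<tau>"
        using weight_12[OF det \<tau>] by (simp_all add: w_def J_def)
      moreover have "J ^ (12 * n) = (J ^ 12) ^ k * (J ^ 12) ^ (n - k)" if "k \<le> n" for k
        using that by (simp add: power_mult flip: power_add)
      ultimately show ?thesis
        unfolding \<Phi>_def sum_distrib_left by (intro sum.cong) (auto simp: power_mult_distrib)
    qed
    ultimately have "\<Phi> \<tau> w = 0" using J by simp
    then show "\<Phi> \<tau> ((of_int \<alpha> * \<tau> + of_int \<beta>) / (of_int \<gamma> * \<tau> + of_int \<delta>)) = 0" by (simp add: w_def J_def)
  qed (use uv ab e0 \<tau> z in \<open>auto simp: R_def\<close>)
  have W0: "W k0 z = 0" if "z \<in> R1" for z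
  proof (rule j_num_modular_disc_homogeneous_independent[OF _ k0(1)])
    show "(\<Sum>k\<le>n. W k z * j_num \<tau> ^ k * modular_disc \<tau> ^ (n - k)) = 0" if "0 < Im \<tau>" for \<tau>
      using zero3[OF that, of z] \<open>z \<in> R1\<close> R1R by (auto simp: \<Phi>_def)
  qed
  have "R1 \<noteq> {}" using uv ab by (simp add: R1_def rect_eq_empty_iff)
  then obtain z1 where "z1 \<in> R1" by blast
  \<comment> \<open>\<open>W k0\<close> vanishes on \<open>R1\<close>, yet its numerator has no zero
    there, and near \<open>z1\<close> there is a point where no denominator vanishes.\<close>
  from eventually_happens[OF evQ[OF this]] obtain z where z: "z \<in> R1" "\<forall>k\<le>n. QG k z \<noteq> 0" by auto
  have "PG k0 z \<noteq> 0" using z(1) R1V(1) PGf[OF k0(1)] by (auto simp: V1_def)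
  then have "W k0 z \<noteq> 0" using z(2) by (simp add: W_def)
  then show False using W0[OF z(1)] by simp
qed

end
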